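(* Consider the Polyhedral Clinching Auction run on the modified market as described in the context, with all participants reporting truthfully. Then $${\rm SW}^{\rm PCA}=\sum_{i\in N}v_ix^{\rm f}_i\ \ge\ \sum_{i\in N}v_ix^*_i={\rm LW}^{\rm OPT}.$$
   Context: Market model. Buyers $N_0=\{1,\dots,n\}$, sellers $M=\{1,\dots,m\}$, bipartite edge set $E_0\subseteq N_0\times M$; edge $(i,j)$ written $ij$; for a set $S$ of participants $E_S$ is the set of edges incident to a member of $S$ ($E_i=E_{\{i\}}$); $w(F)=\sum_{e\in F}w_e$. Each seller $j$ has a monotone submodular $f_j:2^{E_j}\to\mathbb R_+$, $f_j(\emptyset)=0$ ($f_j(E_j)$ = her total amount of a homogeneous divisible good). Buyer $i$ has per-unit valuation $v_i>0$ and budget $B_i\ge0$; seller $j$ has per-unit valuation $\rho_j>0$. Modified market. For each seller $j$ add a virtual buyer $n+j$ adjacent only to $j$ with $v_{n+j}=\rho_j$, $B_{n+j}=\infty$; $N=\{1,\dots,n+m\}$, $E=E_0\cup\{(n+j)j\}$; extend $f_j$ by $f_j(F)=f_j(E_j)$ if $(n+j)j\in F$, unchanged otherwise; $P_j=\{y\in\mathbb R^{E_j}_+:y(F)\le f_j(F)\ \forall F\}$, $P=\{w\in\mathbb R^E_+:w|_{E_j}\in P_j\ \forall j\}$, $f(S)=\sum_jf_j(S\cap E_j)$. The amount $w_{(n+j)j}$ represents goods seller $j$ keeps, so social welfare is $\sum_{i\in N}v_iw(E_i)$ and liquid welfare $\sum_{i\in N}\min(v_iw(E_i),B_i)$. For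 $i\in N$, $H_i$ is the set of buyers $k$ with $v_k>v_i$, or $v_k=v_i$ and $k<i$; $x^*\in\mathbb R^N_+$ is defined recursively (decreasing valuation, ties by index) by $x^*_i=\min(B_i/v_i,\min_{H\subseteq H_i}\{f(E_{H\cup\{i\}})-x^*(H)\})$; ${\rm LW}^{\rm OPT}=\max_{w\in P}\sum_{i\in N}\min(v_iw(E_i),B_i)$. Polyhedral Clinching Auction (PCA) with step $\varepsilon>0$: bids $v'_i$ for $i\in N$ (virtual buyer $n+j$ bids seller $j$'s bid), all assumed to be positive integer multiples of $\varepsilon$. State: $w\in\mathbb R^E_+$, payments $p$, revenues $r$, price clocks $c_i$, demands $d_i\in[0,\infty]$; initially $w=0,p=0,r=0$, $c_i=0$, $d_i=\infty$, pointer $l=1$. For $w,d$ let $P_{w,d}=\{y\in\mathbb R^E_+: w+y\in P,\ y(E_k)\le d_k\ \forall k\}$ and for $\xi\in\mathbb R^{E_i}_+$ let $P^i_{w,d}(\xi)=\{u\in\mathbb R^{N\setminus\{i\}}_+:\exists y\in P_{w,d},\ y|_{E_i}=\xi,\ y(E_k)=u_k\ \forall k\ne i\}$. While some $d_i\neq 0$, an iteration does: (1) clinching step: for $i=1,\dots,n+m$ in turn, choose a maximal $\xi_i\in\mathbb R^{E_i}_+$ with $P^i_{w,d}(\xi_i)=P^i_{w,d}(0)$, set $p_i\leftarrow p_i+c_i\xi_i(E_i)$, $w_{ij}\leftarrow w_{ij}+\xi_{ij}$, and reset every demand to $d_k=(B_k-p_k)/c_k$ if $c_k<v'_k$ and $d_k=0$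 otherwise ($d_k=\infty$ while $c_k=0$); then $r_j\leftarrow r_j+\sum_{ij\in E_j}c_i\xi_{ij}$; (2) $c_l\leftarrow c_l+\varepsilon$ and $d_l\leftarrow(B_l-p_l)/c_l$ if $c_l<v'_l$, else $d_l\leftarrow0$; (3) advance $l$ cyclically. For $i\in N$, $x^{\rm f}_i$ denotes the value of $w(E_i)$ at termination, and ${\rm SW}^{\rm PCA}=\sum_{i\in N}v_ix^{\rm f}_i$. Truthful reporting means $v'_i=v_i$ for all $i\in N$. *)

theory Defs
  imports Complex_Main "HOL-Library.Extended_Real" "HOL-Library.Product_Lexorder"
begin

type_synonym edge = "nat \<times> nat"   (* (buyer, seller) *)

text \<open>The (original) market: buyers 1..nb, sellers 1..ms, edge set E0 (subset of
  buyers x sellers), seller functions fs j on subsets of the seller's edges,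
  buyer valuations val, buyer budgets bud, seller valuations rho.\<close>
record market =
  nb  :: nat
  ms  :: nat
  E0  :: "edge set"
  fs  :: "nat \<Rightarrow> edge set \<Rightarrow> real"
  val :: "nat \<Rightarrow> real"
  bud :: "nat \<Rightarrow> real"
  rho :: "nat \<Rightarrow> real"

definition allN :: "market \<Rightarrow> nat set" where
  "allN M = {1..nb M + ms M}"

definition Emod :: "market \<Rightarrow> edge set" where
  "Emod M = E0 M \<union> {(nb M + j, j) | j. j \<in> {1..ms M}}"

definition Ebuy :: "edge set \<Rightarrow> nat \<Rightarrow> edge set" where
  "Ebuy E i = {e \<in> E. fst e = i}"

definition Ebuys :: "edge set \<Rightarrow> nat set \<Rightarrow> edge set" where
  "Ebuys E S = {e \<in> E. fst e \<in> S}"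

definition Esel :: "edge set \<Rightarrow> nat \<Rightarrow> edge set" where
  "Esel E j = {e \<in> E. snd e = j}"

text \<open>valuations and budgets in the modified market (virtual buyer nb+j has
  valuation rho j and infinite budget)\<close>
definition vm :: "market \<Rightarrow> nat \<Rightarrow> real" where
  "vm M i = (if i \<le> nb M then val M i else rho M (i - nb M))"

definition Bm :: "market \<Rightarrow> nat \<Rightarrow> ereal" where
  "Bm M i = (if i \<le> nb M then ereal (bud M i) else \<infinity>)"

definition fext :: "market \<Rightarrow> nat \<Rightarrow> edge set \<Rightarrow> real" where
  "fext M j F = (if (nb M + j, j) \<in> F then fs M j (Esel (E0 M) j) else fs M j F)"

definition fN :: "market \<Rightarrow> edge set \<Rightarrow> real" where
  "fN M S = (\<Sum>j\<in>{1..ms M}. fext M j (S \<inter> Esel (Emod M) j))"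

text \<open>vectors in R^E_+ (functions supported on E, nonnegative there)\<close>
definition nonneg_on :: "edge set \<Rightarrow> (edge \<Rightarrow> real) \<Rightarrow> bool" where
  "nonneg_on E w \<longleftrightarrow> (\<forall>e\<in>E. 0 \<le> w e) \<and> (\<forall>e. e \<notin> E \<longrightarrow> w e = 0)"

definition inP :: "market \<Rightarrow> (edge \<Rightarrow> real) \<Rightarrow> bool" where
  "inP M w \<longleftrightarrow> nonneg_on (Emod M) w \<and>
     (\<forall>j\<in>{1..ms M}. \<forall>F. F \<subseteq> Esel (Emod M) j \<longrightarrow> sum w F \<le> fext M j F)"

definition LW :: "market \<Rightarrow> (edge \<Rightarrow> real) \<Rightarrow> ereal" where
  "LW M w = (\<Sum>i\<in>allN M. min (ereal (vm M i * sum w (Ebuy (Emod M) i))) (Bm M i))"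

definition LW_OPT :: "market \<Rightarrow> ereal" where
  "LW_OPT M = Sup (LW M ` {w. inP M w})"

definition Hset :: "market \<Rightarrow> nat \<Rightarrow> nat set" where
  "Hset M i = {k \<in> allN M. vm M k > vm M i \<or> (vm M k = vm M i \<and> k < i)}"

definition order_list :: "market \<Rightarrow> nat list" where
  "order_list M = sort_key (\<lambda>i. (- vm M i, i)) [1..<nb M + ms M + 1]"

definition xstar_step :: "market \<Rightarrow> (nat \<Rightarrow> real) \<Rightarrow> nat \<Rightarrow> (nat \<Rightarrow> real)" where
  "xstar_step M x i = x(i := real_of_ereal
     (min (Bm M i / ereal (vm M i))
          (ereal (Min {fN M (Ebuys (Emod M) (H \<union> {i})) - sum x H | H. H \<subseteq> Hset M i}))))"

definition xstar :: "market \<Rightarrow> nat \<Rightarrow> real" where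
  "xstar M = foldl (xstar_step M) (\<lambda>_. 0) (order_list M)"

record pca_state =
  wS :: "edge \<Rightarrow> real"
  pS :: "nat \<Rightarrow> real"
  cS :: "nat \<Rightarrow> real"
  dS :: "nat \<Rightarrow> ereal"
  lS :: nat

text \<open>demand of k given price clocks c, payments p and bids b\<close>
definition dem :: "market \<Rightarrow> (nat \<Rightarrow> real) \<Rightarrow> (nat \<Rightarrow> real) \<Rightarrow> (nat \<Rightarrow> real) \<Rightarrow> nat \<Rightarrow> ereal" where
  "dem M b c p k = (if c k = 0 then \<infinity>
                    else if c k < b k then (Bm M k - ereal (p k)) / ereal (c k) else 0)"

definition Pwd :: "market \<Rightarrow> (edge \<Rightarrow> real) \<Rightarrow> (nat \<Rightarrow> ereal) \<Rightarrow> (edge \<Rightarrow> real) set" where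
  "Pwd M w d = {y. nonneg_on (Emod M) y \<and> inP M (\<lambda>e. w e + y e) \<and>
                   (\<forall>k\<in>allN M. ereal (sum y (Ebuy (Emod M) k)) \<le> d k)}"

text \<open>P^i_{w,d}(xi); vectors in R^{N minus i} represented as functions vanishing outside N minus i\<close>
definition Pproj :: "market \<Rightarrow> (edge \<Rightarrow> real) \<Rightarrow> (nat \<Rightarrow> ereal) \<Rightarrow> nat \<Rightarrow> (edge \<Rightarrow> real) \<Rightarrow> (nat \<Rightarrow> real) set" where
  "Pproj M w d i xi = {u. \<exists>y\<in>Pwd M w d. (\<forall>e\<in>Ebuy (Emod M) i. y e = xi e) \<and>
      u = (\<lambda>k. if k \<in> allN M - {i} then sum y (Ebuy (Emod M) k) else 0)}"

definition clinchable :: "market \<Rightarrow> (edge \<Rightarrow> real) \<Rightarrow> (nat \<Rightarrow> ereal) \<Rightarrow> nat \<Rightarrow> (edge \<Rightarrow> real) \<Rightarrow> bool" where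
  "clinchable M w d i xi \<longleftrightarrow> nonneg_on (Ebuy (Emod M) i) xi \<and>
      Pproj M w d i xi = Pproj M w d i (\<lambda>_. 0)"

definition max_clinchable :: "market \<Rightarrow> (edge \<Rightarrow> real) \<Rightarrow> (nat \<Rightarrow> ereal) \<Rightarrow> nat \<Rightarrow> (edge \<Rightarrow> real) \<Rightarrow> bool" where
  "max_clinchable M w d i xi \<longleftrightarrow> clinchable M w d i xi \<and>
      \<not> (\<exists>xi'. clinchable M w d i xi' \<and> (\<forall>e. xi e \<le> xi' e) \<and> xi' \<noteq> xi)"

definition clinch_one :: "market \<Rightarrow> (nat \<Rightarrow> real) \<Rightarrow> nat \<Rightarrow> pca_state \<Rightarrow> pca_state \<Rightarrow> bool" where
  "clinch_one M b i s s' \<longleftrightarrow> (\<exists>xi. max_clinchable M (wS s) (dS s) i xi \<and>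
     (let p' = (pS s)(i := pS s i + cS s i * sum xi (Ebuy (Emod M) i)) in
      s' = s\<lparr> wS := (\<lambda>e. wS s e + xi e), pS := p', dS := dem M b (cS s) p' \<rparr>))"

inductive clinch_list :: "market \<Rightarrow> (nat \<Rightarrow> real) \<Rightarrow> nat list \<Rightarrow> pca_state \<Rightarrow> pca_state \<Rightarrow> bool"
  for M b where
  Nil: "clinch_list M b [] s s"
| Cons: "clinch_one M b i s s1 \<Longrightarrow> clinch_list M b is s1 s2 \<Longrightarrow> clinch_list M b (i # is) s s2"

definition pca_init :: pca_state where
  "pca_init = \<lparr> wS = (\<lambda>_. 0), pS = (\<lambda>_. 0), cS = (\<lambda>_. 0), dS = (\<lambda>_. \<infinity>), lS = 1 \<rparr>"

definition pca_iter :: "market \<Rightarrow> real \<Rightarrow> (nat \<Rightarrow> real) \<Rightarrow> pca_state \<Rightarrow> pca_state \<Rightarrow> bool" where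
  "pca_iter M eps b s s' \<longleftrightarrow> (\<exists>i\<in>allN M. dS s i \<noteq> 0) \<and>
     (\<exists>s1. clinch_list M b [1..<nb M + ms M + 1] s s1 \<and>
        (let l = lS s1; c' = (cS s1)(l := cS s1 l + eps) in
         s' = s1\<lparr> cS := c', dS := (dS s1)(l := dem M b c' (pS s1) l),
                  lS := l mod (nb M + ms M) + 1 \<rparr>))"

definition pca_final :: "market \<Rightarrow> real \<Rightarrow> (nat \<Rightarrow> real) \<Rightarrow> pca_state \<Rightarrow> bool" where
  "pca_final M eps b s \<longleftrightarrow> (pca_iter M eps b)\<^sup>*\<^sup>* pca_init s \<and> (\<forall>i\<in>allN M. dS s i = 0)"

end

theory Submission
  imports Defs
begin

text \<open>
  Write \<open>r(S)\<close> for the largest amount that the buyers in \<open>S\<close> can still obtain under the current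
  allocation \<open>w\<close> and demands \<open>d\<close>. By polymatroid duality \<open>r(S)\<close> is the minimum of
  \<open>f(F) - w(F) + d(S - H)\<close> over \<open>H \<subseteq> S\<close> and edge sets \<open>F\<close> containing all edges of \<open>H\<close>. The
  potential \<open>w(E\<^sub>S) + r(S)\<close> never drops when somebody clinches. When the price of an active buyer
  \<open>l \<in> S\<close> rises, it is at least the minimum of its old value and of the old potential of
  \<open>S - {l}\<close> plus \<open>B\<^sub>l / v\<^sub>l\<close>, since a buyer who pays at most \<open>v\<^sub>l\<close> per unit can afford
  \<open>B\<^sub>l / v\<^sub>l\<close>. Hence the potential of every set of active buyers stays above its \<open>x\<^sup>*\<close>-value.
  Maximality of the clinched vectors gives \<open>r(N) = r(N - {l})\<close> before each price increase, so
  no good is lost: once all buyers below a valuation level have dropped out, the buyers above that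
  level end up with their full potential. So the final allocation dominates \<open>x\<^sup>*\<close> on every
  level set of the valuations, and summation by parts gives the inequality. The equality is the
  optimality of the greedy vector \<open>x\<^sup>*\<close> in the polymatroid of \<open>S \<mapsto> f(E\<^sub>S)\<close> with caps \<open>B\<^sub>i / v\<^sub>i\<close>.
\<close>

section \<open>Submodular functions and level sets\<close>

lemma Ebuys_subset: "Ebuys E S \<subseteq> E"
  by (auto simp: Ebuys_def)

lemma Ebuys_mono: "S \<subseteq> T \<Longrightarrow> Ebuys E S \<subseteq> Ebuys E T"
  by (auto simp: Ebuys_def)

lemma Ebuys_Un: "Ebuys E (S \<union> T) = Ebuys E S \<union> Ebuys E T"
  by (auto simp: Ebuys_def)

lemma Ebuys_insert: "Ebuys E (insert k T) = Ebuy E k \<union> Ebuys E T"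
  by (auto simp: Ebuys_def Ebuy_def)

lemma Ebuys_empty [simp]: "Ebuys E {} = {}"
  by (auto simp: Ebuys_def)

lemma Ebuy_subset: "Ebuy E k \<subseteq> E"
  by (auto simp: Ebuy_def)

lemma sum_Ebuys:
  fixes y :: "edge \<Rightarrow> real"
  assumes "finite E" "finite S"
  shows "sum y (Ebuys E S) = (\<Sum>k\<in>S. sum y (Ebuy E k))"
proof -
  have "Ebuys E S = (\<Union>k\<in>S. Ebuy E k)"
    by (auto simp: Ebuys_def Ebuy_def)
  moreover have "finite (Ebuy E k)" for k
    using assms finite_subset[OF Ebuy_subset] by blast
  ultimately show ?thesis
    using assms by (simp add: sum.UNION_disjoint Ebuy_def disjoint_iff)
qed

lemma nonneg_on_ge0: "nonneg_on E y \<Longrightarrow> 0 \<le> y e"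
  unfolding nonneg_on_def by (metis order_refl)

lemma nonneg_on_sum_ge0: "nonneg_on E y \<Longrightarrow> 0 \<le> sum y F"
  by (intro sum_nonneg) (auto intro: nonneg_on_ge0)

lemma nonneg_on_mono: "A \<subseteq> E \<Longrightarrow> nonneg_on A y \<Longrightarrow> nonneg_on E y"
  unfolding nonneg_on_def by (metis order_refl subsetD)

lemma nonneg_on_add:
  "nonneg_on E x \<Longrightarrow> nonneg_on E y \<Longrightarrow> nonneg_on E (\<lambda>e. x e + y e)"
  by (auto simp: nonneg_on_def)

text \<open>Induction over the edges: one edge \<open>e\<close> gets a value \<open>a\<close>, and
  the other edges must then realize reduced totals \<open>u'\<close> under a contracted function
  \<open>g'\<close>. Such an \<open>a\<close> exists because uncrossing makes every lower bound on
  it compatible with every upper bound. The function \<open>g\<close> may fail to be monotone (later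
  it is a residual supply), so the condition is stated for every \<open>F\<close> that covers the
  edges of \<open>T\<close>.\<close>

lemma aggregate_realization:
  fixes E :: "edge set" and g :: "edge set \<Rightarrow> real" and u :: "nat \<Rightarrow> real"
  assumes "finite E" "finite N" "fst ` E \<subseteq> N"
    and "\<And>F G. F \<subseteq> E \<Longrightarrow> G \<subseteq> E \<Longrightarrow> g (F \<union> G) + g (F \<inter> G) \<le> g F + g G"
    and "g {} = 0"
    and "\<And>k. k \<in> N \<Longrightarrow> 0 \<le> u k"
    and "\<And>T F. T \<subseteq> N \<Longrightarrow> Ebuys E T \<subseteq> F \<Longrightarrow> F \<subseteq> E \<Longrightarrow> sum u T \<le> g F"
  shows "\<exists>y. nonneg_on E y \<and> (\<forall>F. F \<subseteq> E \<longrightarrow> sum y F \<le> g F) \<and>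
             (\<forall>k\<in>N. sum y (Ebuy E k) = u k)"
  using assms(1,3-)
proof (induction E arbitrary: g u rule: finite_induct)
  case empty
  have "u k = 0" if "k \<in> N" for k
    using empty.prems(4)[OF that] empty.prems(5)[of "{k}" "{}"] empty.prems(3) that
    by (auto simp: Ebuys_def)
  then show ?case
    using empty.prems(3)
    by (intro exI[of _ "\<lambda>_. 0"]) (auto simp: nonneg_on_def Ebuy_def)
next
  case (insert e E)
  define k where "k = fst e"
  have kN: "k \<in> N"
    using insert.prems(1) by (auto simp: k_def)
  note submod = insert.prems(2) and u0 = insert.prems(4) and cond = insert.prems(5)
  have finT: "finite T" if "T \<subseteq> N" for T
    using that assms(2) finite_subset by blast
  have Eb: "Ebuys (insert e E) T = (if k \<in> T then insert e (Ebuys E T) else Ebuys E T)" for T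
    by (auto simp: Ebuys_def k_def)
  define L where "L = {sum u T - g F | T F. T \<subseteq> N \<and> k \<in> T \<and> Ebuys E T \<subseteq> F \<and> F \<subseteq> E}"
  have "L \<subseteq> (\<lambda>(T, F). sum u T - g F) ` (Pow N \<times> Pow E)"
    by (auto simp: L_def)
  then have finL: "finite L"
    using assms(2) insert.hyps(1) by (meson finite_Pow_iff finite_SigmaI finite_imageI finite_subset)
  \<comment> \<open>The smallest amount that \<open>e\<close> must carry for the remaining edges to suffice.\<close>
  define a where "a = Max (insert 0 L)"
  have a0: "0 \<le> a"
    using finL by (simp add: a_def)
  have aL: "sum u T - g F \<le> a" if "T \<subseteq> N" "k \<in> T" "Ebuys E T \<subseteq> F" "F \<subseteq> E" for T F
    using finL that by (auto simp: a_def L_def intro!: Max_ge)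
  have a_in: "a = 0 \<or> a \<in> L"
    using Max_in[of "insert 0 L"] finL by (auto simp: a_def)
  have aU: "a \<le> g (insert e F) - sum u T" if T: "T \<subseteq> N" "k \<notin> T" "Ebuys E T \<subseteq> F" "F \<subseteq> E" for T F
    using a_in
  proof
    assume "a = 0"
    then show ?thesis
      using cond[of T "insert e F"] T by (auto simp: Eb)
  next
    assume "a \<in> L"
    then obtain T1 F1 where 1: "a = sum u T1 - g F1" "T1 \<subseteq> N" "k \<in> T1" "Ebuys E T1 \<subseteq> F1" "F1 \<subseteq> E"
      by (auto simp: L_def)
    \<comment> \<open>Uncross the pair \<open>(T1, F1)\<close> that attains the lower bound with
      \<open>(T, insert e F)\<close>. As \<open>k\<close> is not in \<open>T\<close> and
      \<open>e\<close> is not in \<open>F1\<close>, the intersection is a valid pair that avoids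
      \<open>e\<close>.\<close>
    have "sum u (T1 \<union> T) \<le> g (F1 \<union> insert e F)"
      using 1 T by (intro cond) (auto simp: Ebuys_def k_def)
    moreover have "sum u (T1 \<inter> T) \<le> g (F1 \<inter> insert e F)"
      using 1 T by (intro cond) (auto simp: Ebuys_def k_def)
    moreover have "g (F1 \<union> insert e F) + g (F1 \<inter> insert e F) \<le> g F1 + g (insert e F)"
      using 1 T by (intro submod) auto
    moreover have "sum u (T1 \<union> T) + sum u (T1 \<inter> T) = sum u T1 + sum u T"
      using 1 T finT by (simp add: sum.union_inter)
    ultimately show ?thesis
      using 1 by linarith
  qed
  have ak: "a \<le> u k"
    using a_in
  proof
    assume "a = 0"
    then show ?thesis using u0 kN by simp
  next
    assume "a \<in> L"
    then obtain T1 F1 where 1: "a = sum u T1 - g F1" "T1 \<subseteq> N" "k \<in> T1" "Ebuys E T1 \<subseteq> F1" "F1 \<subseteq> E"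
      by (auto simp: L_def)
    have "sum u (T1 - {k}) \<le> g F1"
      using 1 by (intro cond) (auto simp: Ebuys_def k_def)
    then show ?thesis
      using 1 finT by (simp add: sum_diff1)
  qed
  \<comment> \<open>With \<open>e\<close> carrying \<open>a\<close>, a set \<open>F\<close> of
    remaining edges is bounded by its own constraint and by that of \<open>insert e F\<close>;
    \<open>g'\<close> is the smaller bound.\<close>
  define g' where "g' = (\<lambda>F. min (g F) (g (insert e F) - a))"
  define u' where "u' = u(k := u k - a)"
  have su': "sum u' T = (if k \<in> T then sum u T - a else sum u T)" if "T \<subseteq> N" for T
  proof (cases "k \<in> T")
    case True
    then have "sum u' T = u' k + sum u' (T - {k})" "sum u T = u k + sum u (T - {k})"
      using finT[OF that] by (simp_all add: sum.remove)
    moreover have "sum u' (T - {k}) = sum u (T - {k})"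
      by (rule sum.cong) (auto simp: u'_def)
    ultimately show ?thesis using True by (simp add: u'_def)
  qed (auto simp: u'_def intro: sum.cong)
  have "\<exists>y. nonneg_on E y \<and> (\<forall>F. F \<subseteq> E \<longrightarrow> sum y F \<le> g' F) \<and>
             (\<forall>k\<in>N. sum y (Ebuy E k) = u' k)"
  proof (rule insert.IH)
    show "fst ` E \<subseteq> N" using insert.prems(1) by auto
    show "g' {} = 0"
      using aU[of "{}" "{}"] insert.prems(3) by (simp add: g'_def)
    show "0 \<le> u' j" if "j \<in> N" for j
      using u0 that ak by (auto simp: u'_def)
    show "g' (F \<union> G) + g' (F \<inter> G) \<le> g' F + g' G" if FG: "F \<subseteq> E" "G \<subseteq> E" for F G
    proof -
      have i: "insert e F \<inter> insert e G = insert e (F \<inter> G)" "insert e F \<union> insert e G = insert e (F \<union> G)"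
         "F \<inter> insert e G = F \<inter> G" "insert e F \<inter> G = F \<inter> G"
         "F \<union> insert e G = insert e (F \<union> G)" "insert e F \<union> G = insert e (F \<union> G)"
        using FG insert.hyps(2) by auto
      have "g (F \<union> G) + g (F \<inter> G) \<le> g F + g G"
        "g (insert e (F \<union> G)) + g (insert e (F \<inter> G)) \<le> g (insert e F) + g (insert e G)"
        "g (insert e (F \<union> G)) + g (F \<inter> G) \<le> g F + g (insert e G)"
        "g (insert e (F \<union> G)) + g (F \<inter> G) \<le> g (insert e F) + g G"
        using submod[of F G] submod[of "insert e F" "insert e G"] submod[of F "insert e G"]
          submod[of "insert e F" G] FG unfolding i by blast+
      then show ?thesis unfolding g'_def by linarith
    qed
    show "sum u' T \<le> g' F" if "T \<subseteq> N" "Ebuys E T \<subseteq> F" "F \<subseteq> E" for T F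
    proof (cases "k \<in> T")
      case True
      then have "sum u T \<le> g (insert e F)"
        using that by (intro cond) (auto simp: Eb)
      then show ?thesis
        using True aL[OF that(1) True that(2,3)] su'[OF that(1)] by (simp add: g'_def)
    next
      case False
      then have "sum u T \<le> g F"
        using that by (intro cond) (auto simp: Eb)
      then show ?thesis
        using False aU[OF that(1) False that(2,3)] su'[OF that(1)] by (simp add: g'_def)
    qed
  qed
  then obtain y where y: "nonneg_on E y" "\<And>F. F \<subseteq> E \<Longrightarrow> sum y F \<le> g' F"
    "\<And>j. j \<in> N \<Longrightarrow> sum y (Ebuy E j) = u' j"
    by blast
  define z where "z = y(e := a)"
  have zF: "sum z F = (if e \<in> F then a + sum y (F - {e}) else sum y F)" if "finite F" for F
  proof (cases "e \<in> F")
    case True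
    then have "sum z F = z e + sum z (F - {e})"
      using that by (simp add: sum.remove)
    moreover have "sum z (F - {e}) = sum y (F - {e})"
      by (rule sum.cong) (auto simp: z_def)
    ultimately show ?thesis using True by (simp add: z_def)
  qed (auto simp: z_def intro: sum.cong)
  have "nonneg_on (insert e E) z"
    using y(1) a0 by (auto simp: nonneg_on_def z_def)
  moreover have "sum z F \<le> g F" if F: "F \<subseteq> insert e E" for F
  proof -
    have "finite F" using F insert.hyps(1) finite_subset by blast
    moreover have "sum y (F - {e}) \<le> g' (F - {e})"
      using F by (intro y(2)) auto
    ultimately show ?thesis
      by (cases "e \<in> F") (auto simp: zF g'_def insert_absorb)
  qed
  moreover have "sum z (Ebuy (insert e E) j) = u j" if "j \<in> N" for j
  proof -
    have "finite (Ebuy (insert e E) j)"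
      using finite_subset[OF Ebuy_subset] insert.hyps(1) by blast
    moreover have "Ebuy (insert e E) j - {e} = Ebuy E j" "e \<in> Ebuy (insert e E) j \<longleftrightarrow> j = k"
      "j \<noteq> k \<Longrightarrow> Ebuy (insert e E) j = Ebuy E j"
      using insert.hyps(2) by (auto simp: Ebuy_def k_def)
    ultimately show ?thesis
      using y(3)[OF that] zF[of "Ebuy (insert e E) j"] by (cases "j = k") (simp_all add: u'_def)
  qed
  ultimately show ?case by blast
qed

text \<open>Summation by parts. With \<open>m\<close> the smallest weight, the sum is
  \<open>m * sum a N\<close>, nonnegative by the hypothesis at threshold \<open>m\<close>, plus the
  same expression with weights \<open>v i - m\<close> on the smaller set where these are positive.
  This turns domination on all level sets into an inequality of welfares.\<close>

lemma level_set_weighted_sum_nonneg: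
  fixes v a :: "'a \<Rightarrow> real"
  assumes "finite N" "\<And>i. i \<in> N \<Longrightarrow> 0 < v i"
    and "\<And>\<theta>. \<theta> \<in> v ` N \<Longrightarrow> 0 \<le> sum a {i \<in> N. \<theta> \<le> v i}"
  shows "0 \<le> (\<Sum>i\<in>N. v i * a i)"
  using assms
proof (induction N arbitrary: v rule: finite_psubset_induct)
  case (psubset N)
  show ?case
  proof (cases "N = {}")
    case False
    define m where "m = Min (v ` N)"
    have m_le: "m \<le> v i" if "i \<in> N" for i
      using that psubset.hyps by (simp add: m_def)
    have m_in: "m \<in> v ` N"
      unfolding m_def using False psubset.hyps by (intro Min_in) auto
    define N' where "N' = {i \<in> N. m < v i}"
    have "N' \<subset> N" using m_in by (auto simp: N'_def)
    moreover have "0 \<le> sum a {i \<in> N'. \<theta> \<le> v i - m}" if "\<theta> \<in> (\<lambda>i. v i - m) ` N'" for \<theta>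
    proof -
      obtain k where k: "k \<in> N'" "\<theta> = v k - m" using \<open>\<theta> \<in> _\<close> by blast
      then have "{i \<in> N'. \<theta> \<le> v i - m} = {i \<in> N. v k \<le> v i}"
        by (auto simp: N'_def)
      then show ?thesis using psubset.prems(2)[of "v k"] k by (auto simp: N'_def)
    qed
    ultimately have "0 \<le> (\<Sum>i\<in>N'. (v i - m) * a i)"
      by (intro psubset.IH) (auto simp: N'_def)
    also have "\<dots> = (\<Sum>i\<in>N. (v i - m) * a i)"
      using psubset.hyps m_le by (intro sum.mono_neutral_left) (force simp: N'_def)+
    also have "\<dots> = (\<Sum>i\<in>N. v i * a i) - m * sum a N"
      by (simp add: left_diff_distrib sum_subtractf sum_distrib_left)
    finally have "m * sum a N \<le> (\<Sum>i\<in>N. v i * a i)" by simp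
    moreover have "{i \<in> N. m \<le> v i} = N" using m_le by auto
    then have "0 \<le> sum a N" using psubset.prems(2)[OF m_in] by simp
    moreover have "0 < m" using m_in psubset.prems(1) by auto
    ultimately show ?thesis by (smt (verit) mult_nonneg_nonneg)
  qed simp
qed

text \<open>Greedy construction of a base of a polymatroid: each new element receives its marginal
  value. Marginal values decrease under enlargement of the set, so sets containing the new element
  stay within \<open>h\<close>.\<close>

lemma greedy_base:
  fixes h :: "'a set \<Rightarrow> real"
  assumes "finite S" "h {} = 0"
    and "\<And>A B. A \<subseteq> B \<Longrightarrow> B \<subseteq> S \<Longrightarrow> h A \<le> h B"
    and "\<And>A B. A \<subseteq> S \<Longrightarrow> B \<subseteq> S \<Longrightarrow> h (A \<union> B) + h (A \<inter> B) \<le> h A + h B"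
  shows "\<exists>u. (\<forall>k. 0 \<le> u k) \<and> (\<forall>k. k \<notin> S \<longrightarrow> u k = 0) \<and> sum u S = h S \<and>
             (\<forall>T. T \<subseteq> S \<longrightarrow> sum u T \<le> h T)"
  using assms
proof (induction S rule: finite_induct)
  case empty
  then show ?case by (intro exI[of _ "\<lambda>_. 0"]) auto
next
  case (insert k S)
  have "\<exists>u. (\<forall>k. 0 \<le> u k) \<and> (\<forall>k. k \<notin> S \<longrightarrow> u k = 0) \<and> sum u S = h S \<and>
             (\<forall>T. T \<subseteq> S \<longrightarrow> sum u T \<le> h T)"
    by (rule insert.IH) (use insert.prems in \<open>auto simp: subset_insertI2\<close>)
  then obtain u where u: "\<And>k. 0 \<le> u k" "\<And>k. k \<notin> S \<Longrightarrow> u k = 0" "sum u S = h S"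
    "\<And>T. T \<subseteq> S \<Longrightarrow> sum u T \<le> h T"
    by blast
  define z where "z = u(k := h (insert k S) - h S)"
  have zu: "sum z T = sum u T" if "k \<notin> T" for T
    using that by (auto simp: z_def intro: sum.cong)
  have "h S \<le> h (insert k S)"
    by (intro insert.prems) auto
  then have "0 \<le> z j" for j
    using u(1) by (auto simp: z_def)
  moreover have "z j = 0" if "j \<notin> insert k S" for j
    using that u(2) by (auto simp: z_def)
  moreover have "sum z (insert k S) = h (insert k S)"
    using insert.hyps zu[of S] u(3) by (simp add: z_def)
  moreover have "sum z T \<le> h T" if T: "T \<subseteq> insert k S" for T
  proof (cases "k \<in> T")
    case False
    then show ?thesis using T zu u(4)[of T] by auto
  next
    case True
    have "finite T" using T insert.hyps finite_subset by blast
    then have "sum z T = z k + sum u (T - {k})"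
      using True zu[of "T - {k}"] by (simp add: sum.remove)
    moreover have "sum u (T - {k}) \<le> h (T - {k})"
      using T by (intro u(4)) auto
    moreover have "h (T \<union> S) + h (T \<inter> S) \<le> h T + h S"
      using T by (intro insert.prems) auto
    moreover have "T \<union> S = insert k S" "T \<inter> S = T - {k}"
      using T True insert.hyps by auto
    ultimately show ?thesis by (simp add: z_def)
  qed
  ultimately show ?case by blast
qed

section \<open>The rank of a set of buyers under demand caps\<close>

text \<open>In a pair \<open>(F, H)\<close> the buyers of \<open>H\<close> are bounded through edges
  in \<open>F\<close>, those of \<open>S - H\<close> through their demands. Infinite demands are
  excluded from \<open>S - H\<close> because \<open>real_of_ereal\<close> would send them to
  0.\<close>

definition duals :: "edge set \<Rightarrow> (nat \<Rightarrow> ereal) \<Rightarrow> nat set \<Rightarrow> (edge set \<times> nat set) set" where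
  "duals E D S = {(F, H). F \<subseteq> E \<and> H \<subseteq> S \<and> Ebuys E H \<subseteq> F \<and> (\<forall>k\<in>S - H. D k \<noteq> \<infinity>)}"

definition dual_value :: "(edge set \<Rightarrow> real) \<Rightarrow> (nat \<Rightarrow> ereal) \<Rightarrow> nat set \<Rightarrow> edge set \<times> nat set \<Rightarrow> real" where
  "dual_value g D S = (\<lambda>(F, H). g F + (\<Sum>k\<in>S - H. real_of_ereal (D k)))"

text \<open>Defined by the dual minimum, which makes submodularity and the comparison of two states
  a matter of manipulating pairs. \<open>weak_duality\<close> and \<open>strong_duality\<close>
  identify it with the largest total that \<open>S\<close> can receive.\<close>

definition rank_fn :: "edge set \<Rightarrow> (edge set \<Rightarrow> real) \<Rightarrow> (nat \<Rightarrow> ereal) \<Rightarrow> nat set \<Rightarrow> real" where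
  "rank_fn E g D S = Min (dual_value g D S ` duals E D S)"

definition feasible :: "edge set \<Rightarrow> nat set \<Rightarrow> (edge set \<Rightarrow> real) \<Rightarrow> (nat \<Rightarrow> ereal) \<Rightarrow> (edge \<Rightarrow> real) \<Rightarrow> bool" where
  "feasible E N g D y \<longleftrightarrow> nonneg_on E y \<and> (\<forall>F. F \<subseteq> E \<longrightarrow> sum y F \<le> g F) \<and>
     (\<forall>k\<in>N. ereal (sum y (Ebuy E k)) \<le> D k)"

locale residual =
  fixes E :: "edge set" and N :: "nat set" and g :: "edge set \<Rightarrow> real" and D :: "nat \<Rightarrow> ereal"
  assumes finE: "finite E" and finN: "finite N" and E_N: "fst ` E \<subseteq> N"
    and submod: "\<And>F G. F \<subseteq> E \<Longrightarrow> G \<subseteq> E \<Longrightarrow> g (F \<union> G) + g (F \<inter> G) \<le> g F + g G"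
    and g_empty: "g {} = 0"
    and g_nonneg: "\<And>F. F \<subseteq> E \<Longrightarrow> 0 \<le> g F"
    and D_nonneg: "\<And>k. k \<in> N \<Longrightarrow> 0 \<le> D k"
begin

abbreviation "rk \<equiv> rank_fn E g D"
abbreviation "cap A \<equiv> (\<Sum>k\<in>A. real_of_ereal (D k))"

lemma finite_sub: "F \<subseteq> E \<Longrightarrow> finite F" "S \<subseteq> N \<Longrightarrow> finite S"
  using finE finN finite_subset by blast+

lemma finite_duals: "S \<subseteq> N \<Longrightarrow> finite (duals E D S)"
proof -
  assume "S \<subseteq> N"
  then have "finite S" using finite_sub by blast
  moreover have "duals E D S \<subseteq> Pow E \<times> Pow S"
    by (auto simp: duals_def)
  ultimately show ?thesis using finE by (meson finite_Pow_iff finite_SigmaI finite_subset)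
qed

lemma rk_le:
  assumes "S \<subseteq> N" "F \<subseteq> E" "H \<subseteq> S" "Ebuys E H \<subseteq> F" "\<And>k. k \<in> S - H \<Longrightarrow> D k \<noteq> \<infinity>"
  shows "rk S \<le> g F + cap (S - H)"
proof -
  have "(F, H) \<in> duals E D S"
    using assms by (auto simp: duals_def)
  then have "rk S \<le> dual_value g D S (F, H)"
    unfolding rank_fn_def using finite_duals[OF assms(1)] by (intro Min_le) auto
  then show ?thesis by (simp add: dual_value_def)
qed

lemma rk_attained:
  assumes "S \<subseteq> N"
  obtains F H where "F \<subseteq> E" "H \<subseteq> S" "Ebuys E H \<subseteq> F" "\<And>k. k \<in> S - H \<Longrightarrow> D k \<noteq> \<infinity>"
    "rk S = g F + cap (S - H)"
proof -
  have "(E, S) \<in> duals E D S"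
    by (auto simp: duals_def Ebuys_def)
  then have "rk S \<in> dual_value g D S ` duals E D S"
    unfolding rank_fn_def using finite_duals[OF assms] by (intro Min_in) auto
  then show thesis
    using that by (auto simp: duals_def dual_value_def)
qed

lemma cap_nonneg: "k \<in> N \<Longrightarrow> 0 \<le> real_of_ereal (D k)"
  using D_nonneg by (simp add: real_of_ereal_pos)

lemma cap_mono: "A \<subseteq> B \<Longrightarrow> B \<subseteq> N \<Longrightarrow> cap A \<le> cap B"
  using finite_sub cap_nonneg by (intro sum_mono2) auto

lemma cap_Un_disjoint: "A \<union> B \<subseteq> N \<Longrightarrow> A \<inter> B = {} \<Longrightarrow> cap (A \<union> B) = cap A + cap B"
  using finite_sub by (intro sum.union_disjoint) auto

lemma cap_split: "A \<subseteq> B \<Longrightarrow> B \<subseteq> N \<Longrightarrow> cap B = cap A + cap (B - A)"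
  using cap_Un_disjoint[of A "B - A"] by (simp add: Un_absorb1)

lemma rk_nonneg: "S \<subseteq> N \<Longrightarrow> 0 \<le> rk S"
  using rk_attained[of S] g_nonneg cap_nonneg
  by (metis (no_types, lifting) DiffD1 add_nonneg_nonneg subsetD sum_nonneg)

lemma rk_empty: "rk {} = 0"
  using rk_le[of "{}" "{}" "{}"] rk_nonneg[of "{}"] g_empty by simp

lemma rk_mono:
  assumes "S \<subseteq> T" "T \<subseteq> N"
  shows "rk S \<le> rk T"
proof -
  obtain F H where FH: "F \<subseteq> E" "H \<subseteq> T" "Ebuys E H \<subseteq> F" "\<And>k. k \<in> T - H \<Longrightarrow> D k \<noteq> \<infinity>"
    "rk T = g F + cap (T - H)"
    using rk_attained[OF assms(2)] by blast
  have "rk S \<le> g F + cap (S - (H \<inter> S))"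
    using assms FH Ebuys_mono[of "H \<inter> S" H E] by (intro rk_le) blast+
  also have "\<dots> \<le> g F + cap (T - H)"
    using assms by (intro add_left_mono cap_mono) auto
  finally show ?thesis using FH by simp
qed

text \<open>Uncrossing of optimal pairs \<open>(F, H)\<close> and \<open>(F', H')\<close>: unions
  serve \<open>S \<union> T\<close>, intersections serve \<open>S \<inter> T\<close>. The two sets
  of capped buyers that result have their union and intersection inside those of
  \<open>S - H\<close> and \<open>T - H'\<close>, so the caps do not grow.\<close>

lemma rk_submodular:
  assumes "S \<subseteq> N" "T \<subseteq> N"
  shows "rk (S \<union> T) + rk (S \<inter> T) \<le> rk S + rk T"
proof -
  obtain F H where 1: "F \<subseteq> E" "H \<subseteq> S" "Ebuys E H \<subseteq> F" "\<And>k. k \<in> S - H \<Longrightarrow> D k \<noteq> \<infinity>"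
    "rk S = g F + cap (S - H)"
    using rk_attained[OF assms(1)] by blast
  obtain F' H' where 2: "F' \<subseteq> E" "H' \<subseteq> T" "Ebuys E H' \<subseteq> F'" "\<And>k. k \<in> T - H' \<Longrightarrow> D k \<noteq> \<infinity>"
    "rk T = g F' + cap (T - H')"
    using rk_attained[OF assms(2)] by blast
  define A where "A = S \<union> T - (H \<union> H')"
  define B where "B = S \<inter> T - (H \<inter> H')"
  have "rk (S \<union> T) \<le> g (F \<union> F') + cap A"
    unfolding A_def using assms 1 2 by (intro rk_le) (auto simp: Ebuys_Un)
  moreover have "rk (S \<inter> T) \<le> g (F \<inter> F') + cap B"
    unfolding B_def using assms 1 2 by (intro rk_le) (auto simp: Ebuys_def)
  moreover have "g (F \<union> F') + g (F \<inter> F') \<le> g F + g F'"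
    using 1 2 by (intro submod)
  moreover have "cap A + cap B \<le> cap (S - H) + cap (T - H')"
  proof -
    have fin: "finite A" "finite B" "finite (S - H)" "finite (T - H')"
      using assms finite_sub by (auto simp: A_def B_def)
    have "cap A + cap B = cap (A \<union> B) + cap (A \<inter> B)"
      using fin by (simp add: sum.union_inter)
    also have "\<dots> \<le> cap ((S - H) \<union> (T - H')) + cap ((S - H) \<inter> (T - H'))"
      using assms by (intro add_mono cap_mono) (auto simp: A_def B_def)
    also have "\<dots> = cap (S - H) + cap (T - H')"
      using fin by (simp add: sum.union_inter)
    finally show ?thesis .
  qed
  ultimately show ?thesis using 1 2 by linarith
qed

section \<open>Duality between feasible vectors and the rank\<close>

lemma weak_duality:
  assumes "feasible E N g D y" "S \<subseteq> N"
  shows "(\<Sum>k\<in>S. sum y (Ebuy E k)) \<le> rk S"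
proof -
  obtain F H where 1: "F \<subseteq> E" "H \<subseteq> S" "Ebuys E H \<subseteq> F" "\<And>k. k \<in> S - H \<Longrightarrow> D k \<noteq> \<infinity>"
    "rk S = g F + cap (S - H)"
    using rk_attained[OF assms(2)] by blast
  have nn: "nonneg_on E y" using assms by (simp add: feasible_def)
  have fS: "finite S" using assms finite_sub by blast
  have "(\<Sum>k\<in>S. sum y (Ebuy E k)) = (\<Sum>k\<in>S - H. sum y (Ebuy E k)) + (\<Sum>k\<in>H. sum y (Ebuy E k))"
    using fS 1(2) by (rule sum.subset_diff[rotated])
  also have "(\<Sum>k\<in>H. sum y (Ebuy E k)) = sum y (Ebuys E H)"
    using sum_Ebuys finE fS 1(2) finite_subset by metis
  also have "\<dots> \<le> sum y F"
    using 1 finite_sub nonneg_on_ge0[OF nn] by (intro sum_mono2) auto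
  also have "\<dots> \<le> g F"
    using assms(1) 1(1) by (simp add: feasible_def)
  also have "(\<Sum>k\<in>S - H. sum y (Ebuy E k)) \<le> cap (S - H)"
  proof (rule sum_mono)
    fix k assume k: "k \<in> S - H"
    then have "ereal (sum y (Ebuy E k)) \<le> D k" "D k \<noteq> \<infinity>" "0 \<le> D k"
      using assms 1(4) D_nonneg by (auto simp: feasible_def)
    then show "sum y (Ebuy E k) \<le> real_of_ereal (D k)"
      by (cases "D k") auto
  qed
  finally show ?thesis using 1 by simp
qed

text \<open>A greedy base \<open>u\<close> of the rank on \<open>S\<close> gives the buyers' totals.
  The pairs \<open>(F, T \<inter> S)\<close> show that \<open>u\<close> satisfies the condition of
  \<open>aggregate_realization\<close>, and the pair \<open>({}, {})\<close> for a single buyer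
  shows that \<open>u\<close> respects the demands.\<close>

lemma strong_duality:
  assumes S: "S \<subseteq> N"
  obtains y where "feasible E N g D y" "(\<Sum>k\<in>S. sum y (Ebuy E k)) = rk S"
proof -
  have "\<exists>u. (\<forall>k. 0 \<le> u k) \<and> (\<forall>k. k \<notin> S \<longrightarrow> u k = 0) \<and> sum u S = rk S \<and>
             (\<forall>T. T \<subseteq> S \<longrightarrow> sum u T \<le> rk T)"
    using S finite_sub by (intro greedy_base rk_empty rk_mono rk_submodular) auto
  then obtain u where u: "\<And>k. 0 \<le> u k" "\<And>k. k \<notin> S \<Longrightarrow> u k = 0" "sum u S = rk S"
    "\<And>T. T \<subseteq> S \<Longrightarrow> sum u T \<le> rk T"
    by blast
  have "\<exists>y. nonneg_on E y \<and> (\<forall>F. F \<subseteq> E \<longrightarrow> sum y F \<le> g F) \<and> (\<forall>k\<in>N. sum y (Ebuy E k) = u k)"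
  proof (rule aggregate_realization[OF finE finN E_N submod g_empty u(1)])
    fix T F assume TF: "T \<subseteq> N" "Ebuys E T \<subseteq> F" "F \<subseteq> E"
    have "sum u T = sum u (T \<inter> S)"
      using TF(1) finite_sub u(2) by (intro sum.mono_neutral_right) auto
    also have "\<dots> \<le> rk (T \<inter> S)"
      by (intro u(4)) auto
    also have "\<dots> \<le> g F"
      using rk_le[of "T \<inter> S" F "T \<inter> S"] S TF Ebuys_mono[of "T \<inter> S" T E] by (simp add: le_infI1)
    finally show "sum u T \<le> g F" .
  qed
  then obtain y where y: "nonneg_on E y" "\<And>F. F \<subseteq> E \<Longrightarrow> sum y F \<le> g F"
    "\<And>k. k \<in> N \<Longrightarrow> sum y (Ebuy E k) = u k"
    by blast
  have "ereal (u k) \<le> D k" if k: "k \<in> N" for k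
  proof (cases "k \<in> S \<and> D k \<noteq> \<infinity>")
    case True
    then have "u k \<le> rk {k}"
      using u(4)[of "{k}"] by auto
    also have "\<dots> \<le> real_of_ereal (D k)"
      using rk_le[of "{k}" "{}" "{}"] True k g_empty by auto
    finally show ?thesis
      using True D_nonneg[OF k] by (cases "D k") auto
  qed (use u(2)[of k] D_nonneg[OF k] in \<open>auto simp flip: zero_ereal_def\<close>)
  then have "feasible E N g D y"
    using y by (auto simp: feasible_def)
  moreover have "(\<Sum>k\<in>S. sum y (Ebuy E k)) = rk S"
    using y(3) S u(3) by (metis (no_types, lifting) subsetD sum.cong)
  ultimately show thesis using that by blast
qed

text \<open>A dual solution of \<open>S - {i}\<close> becomes one of \<open>S\<close> when
  \<open>i\<close> joins the capped buyers.\<close>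

lemma rk_remove_le:
  assumes "S \<subseteq> N" "i \<in> S" "D i \<noteq> \<infinity>"
  shows "rk S \<le> rk (S - {i}) + real_of_ereal (D i)"
proof -
  have "S - {i} \<subseteq> N" using assms by auto
  then obtain F H where FH: "F \<subseteq> E" "H \<subseteq> S - {i}" "Ebuys E H \<subseteq> F"
    "\<And>k. k \<in> S - {i} - H \<Longrightarrow> D k \<noteq> \<infinity>" "rk (S - {i}) = g F + cap (S - {i} - H)"
    using rk_attained by blast
  have "D k \<noteq> \<infinity>" if "k \<in> S - H" for k
    using FH(4)[of k] that assms(3) by (cases "k = i") auto
  then have "rk S \<le> g F + cap (S - H)"
    using assms FH(1-3) by (intro rk_le) auto
  also have "cap (S - H) = real_of_ereal (D i) + cap (S - H - {i})"
    using assms FH finite_sub by (intro sum.remove) auto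
  also have "S - H - {i} = S - {i} - H" by auto
  finally show ?thesis using FH by simp
qed

text \<open>Fixing an optimal dual solution of \<open>N - {i}\<close>, an edge of \<open>i\<close> on which nothing can be clinched
  lies in a set that is tight given this solution; tight sets are closed under unions, and a tight
  set containing all edges of \<open>i\<close> is a dual solution for \<open>N\<close> of the same value.\<close>

lemma rk_remove_unclinchable:
  assumes iN: "i \<in> N"
    and no: "\<And>e \<delta>. e \<in> Ebuy E i \<Longrightarrow> 0 < \<delta> \<Longrightarrow>
      \<exists>y. feasible E N g D y \<and> \<not> (\<exists>z. feasible E N g D z \<and>
            (\<forall>e'\<in>Ebuy E i. z e' = (if e' = e then \<delta> else 0)) \<and>
            (\<forall>k\<in>N - {i}. sum z (Ebuy E k) = sum y (Ebuy E k)))"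
  shows "rk N \<le> rk (N - {i})"
proof (rule ccontr)
  assume neg: "\<not> rk N \<le> rk (N - {i})"
  obtain Fs Hs where s: "Fs \<subseteq> E" "Hs \<subseteq> N - {i}" "Ebuys E Hs \<subseteq> Fs"
    "\<And>k. k \<in> N - {i} - Hs \<Longrightarrow> D k \<noteq> \<infinity>" "rk (N - {i}) = g Fs + cap (N - {i} - Hs)"
    using rk_attained[of "N - {i}"] by blast
  define R where "R = N - {i} - Hs"
  have RN: "R \<subseteq> N" by (auto simp: R_def)
  \<comment> \<open>Optimality of \<open>(Fs, Hs)\<close>: moving the buyers of \<open>T\<close>
    from the capped side to the edge side saves \<open>cap T\<close>, and so must cost at least that
    much in \<open>g\<close>.\<close>
  have lower: "g Fs + cap T \<le> g F" if "F \<subseteq> E" "T \<subseteq> R" "Fs \<union> Ebuys E T \<subseteq> F" for F T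
  proof -
    have "rk (N - {i}) \<le> g F + cap (N - {i} - (Hs \<union> T))"
      using that s by (intro rk_le) (auto simp: R_def Ebuys_Un)
    moreover have "N - {i} - (Hs \<union> T) = R - T" by (auto simp: R_def)
    moreover have "cap R = cap T + cap (R - T)"
      using that RN by (intro cap_split)
    ultimately show ?thesis using s(5) by (simp add: R_def)
  qed
  define tight where "tight F T \<longleftrightarrow> F \<subseteq> E \<and> T \<subseteq> R \<and> Fs \<union> Ebuys E T \<subseteq> F \<and> g F \<le> g Fs + cap T" for F T
  have tight_Un: "tight (F1 \<union> F2) (T1 \<union> T2)" if t: "tight F1 T1" "tight F2 T2" for F1 F2 T1 T2
  proof -
    have "g Fs + cap (T1 \<inter> T2) \<le> g (F1 \<inter> F2)"
      using t by (intro lower) (auto simp: tight_def Ebuys_def)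
    moreover have "g (F1 \<union> F2) + g (F1 \<inter> F2) \<le> g F1 + g F2"
      using t by (intro submod) (auto simp: tight_def)
    moreover have "cap (T1 \<union> T2) + cap (T1 \<inter> T2) = cap T1 + cap T2"
      using t RN finite_sub by (intro sum.union_inter) (auto simp: tight_def)
    ultimately show ?thesis
      using t by (auto simp: tight_def Ebuys_Un)
  qed
  have "\<exists>e\<in>Ebuy E i. \<forall>F T. tight F T \<longrightarrow> e \<notin> F"
  proof (rule ccontr)
    assume "\<not> ?thesis"
    then have ex: "\<And>e. e \<in> Ebuy E i \<Longrightarrow> \<exists>F T. tight F T \<and> e \<in> F" by blast
    have fin: "finite (Ebuy E i)" by (rule finite_sub(1)[OF Ebuy_subset])
    have "\<exists>F T. tight F T \<and> A \<subseteq> F" if "finite A" "A \<subseteq> Ebuy E i" for A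
      using that
    proof (induction A rule: finite_induct)
      case empty
      have "tight Fs {}" using s by (auto simp: tight_def)
      then show ?case by blast
    next
      case (insert e A)
      obtain F1 T1 where "tight F1 T1" "A \<subseteq> F1" using insert by auto
      moreover obtain F2 T2 where "tight F2 T2" "e \<in> F2" using ex insert.prems by blast
      ultimately show ?case using tight_Un[of F1 T1 F2 T2] by blast
    qed
    then obtain F T where FT: "tight F T" "Ebuy E i \<subseteq> F" using fin by blast
    have "rk N \<le> g F + cap (N - insert i (Hs \<union> T))"
      using FT s iN by (intro rk_le) (auto simp: tight_def R_def Ebuys_insert Ebuys_Un)
    moreover have "N - insert i (Hs \<union> T) = R - T" by (auto simp: R_def)
    moreover have "cap R = cap T + cap (R - T)"
      using FT RN by (intro cap_split) (auto simp: tight_def)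
    ultimately show False using FT neg s(5) by (simp add: R_def tight_def)
  qed
  then obtain e where e: "e \<in> Ebuy E i" "\<And>F T. tight F T \<Longrightarrow> e \<notin> F" by blast
  have eE: "e \<in> E" "fst e = i" using e(1) by (auto simp: Ebuy_def)
  \<comment> \<open>Slacks of all candidate sets that contain \<open>e\<close>. They are positive
    since \<open>e\<close> lies in no tight set, so the smallest one leaves room for a positive
    \<delta> on \<open>e\<close>.\<close>
  define L where "L = {g F - g Fs - cap T | F T. F \<subseteq> E \<and> T \<subseteq> R \<and> Fs \<union> Ebuys E T \<subseteq> F \<and> e \<in> F}"
  have "L \<subseteq> (\<lambda>(F, T). g F - g Fs - cap T) ` (Pow E \<times> Pow R)"
    by (auto simp: L_def)
  moreover have "finite (Pow E \<times> Pow R)" using finE finite_sub(2)[OF RN] by simp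
  ultimately have finL: "finite L" using finite_surj by blast
  have "g E - g Fs - cap {} \<in> L"
    unfolding L_def using s(1) eE by (intro CollectI exI[of _ E] exI[of _ "{}"]) auto
  then have L_ne: "L \<noteq> {}" by blast
  have L_pos: "0 < x" if "x \<in> L" for x
  proof (rule ccontr)
    assume neg: "\<not> 0 < x"
    obtain F T where FT: "x = g F - g Fs - cap T" "F \<subseteq> E" "T \<subseteq> R" "Fs \<union> Ebuys E T \<subseteq> F" "e \<in> F"
      using \<open>x \<in> L\<close> unfolding L_def by blast
    then have "tight F T" using neg by (simp add: tight_def)
    then show False using e(2) FT(5) by blast
  qed
  define \<delta> where "\<delta> = (if D i = \<infinity> then Min L else min (Min L) (real_of_ereal (D i)))"
  \<comment> \<open>By \<open>rk_remove_le\<close>, a zero demand of \<open>i\<close> would already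
    give the claim.\<close>
  have "0 < real_of_ereal (D i)" if "D i \<noteq> \<infinity>"
    using rk_remove_le[OF order_refl iN that] neg by linarith
  then have \<delta>_pos: "0 < \<delta>"
    using L_pos Min_in[OF finL L_ne] by (simp add: \<delta>_def)
  have \<delta>_D: "ereal \<delta> \<le> D i"
    using D_nonneg[OF iN] by (cases "D i") (auto simp: \<delta>_def)
  have \<delta>_L: "g Fs + cap T + \<delta> \<le> g F" if "F \<subseteq> E" "T \<subseteq> R" "Fs \<union> Ebuys E T \<subseteq> F" "e \<in> F" for F T
  proof -
    have "g F - g Fs - cap T \<in> L" using that by (auto simp: L_def)
    then have "Min L \<le> g F - g Fs - cap T" using finL by simp
    moreover have "\<delta> \<le> Min L" by (simp add: \<delta>_def)
    ultimately show ?thesis by linarith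
  qed
  obtain y where y: "feasible E N g D y"
    and ynot: "\<not> (\<exists>z. feasible E N g D z \<and>
            (\<forall>e'\<in>Ebuy E i. z e' = (if e' = e then \<delta> else 0)) \<and>
            (\<forall>k\<in>N - {i}. sum z (Ebuy E k) = sum y (Ebuy E k)))"
    using no[OF e(1) \<delta>_pos] by blast
  have yn: "nonneg_on E y" and yg: "\<And>F. F \<subseteq> E \<Longrightarrow> sum y F \<le> g F"
    and yD: "\<And>k. k \<in> N \<Longrightarrow> ereal (sum y (Ebuy E k)) \<le> D k"
    using y by (auto simp: feasible_def)
  define u where "u = (\<lambda>k. if k = i then 0 else sum y (Ebuy E k))"
  have u0: "0 \<le> u k" for k
    using nonneg_on_sum_ge0[OF yn] by (simp add: u_def)
  have u_le: "sum u T \<le> g F" if "T \<subseteq> N" "Ebuys E T \<subseteq> F" "F \<subseteq> E" for T F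
  proof -
    have "sum u T \<le> (\<Sum>k\<in>T. sum y (Ebuy E k))"
      using nonneg_on_sum_ge0[OF yn] by (intro sum_mono) (simp add: u_def)
    also have "\<dots> = sum y (Ebuys E T)"
      using sum_Ebuys finE finite_sub that by metis
    also have "\<dots> \<le> sum y F"
      using that finite_sub nonneg_on_ge0[OF yn] by (intro sum_mono2) auto
    finally show ?thesis using yg[OF that(3)] by simp
  qed
  \<comment> \<open>Reserving \<delta> on \<open>e\<close>: if the totals \<open>u\<close>, with 0
    for \<open>i\<close>, are realizable under \<open>g2\<close>, then adding \<delta> on
    \<open>e\<close> afterwards gives the vector that \<open>ynot\<close> forbids.\<close>
  define g2 where "g2 = (\<lambda>F. g F - (if e \<in> F then \<delta> else 0))"
  have "\<exists>y. nonneg_on E y \<and> (\<forall>F. F \<subseteq> E \<longrightarrow> sum y F \<le> g2 F) \<and> (\<forall>k\<in>N. sum y (Ebuy E k) = u k)"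
  proof (rule aggregate_realization[OF finE finN E_N _ _ u0])
    show "g2 (F \<union> G) + g2 (F \<inter> G) \<le> g2 F + g2 G" if "F \<subseteq> E" "G \<subseteq> E" for F G
      using submod[OF that] by (auto simp: g2_def)
    show "g2 {} = 0" using g_empty by (simp add: g2_def)
    fix T F assume TF: "T \<subseteq> N" "Ebuys E T \<subseteq> F" "F \<subseteq> E"
    show "sum u T \<le> g2 F"
    proof (cases "e \<in> F")
      case False
      then show ?thesis using u_le[OF TF] by (simp add: g2_def)
    next
      case True
      define T' where "T' = T - {i}"
      have "finite T" using TF finite_sub by blast
      then have "sum u T = sum u T'"
        unfolding T'_def by (intro sum.mono_neutral_right) (auto simp: u_def)
      \<comment> \<open>Buyers in \<open>Hs\<close> are bounded through
        \<open>F \<inter> Fs\<close>, the others through their caps. The slack of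
        \<open>F \<union> Fs\<close>, which contains \<open>e\<close>, then pays for \<delta> by
        submodularity.\<close>
      also have "\<dots> = sum u (T' \<inter> Hs) + sum u (T' - Hs)"
        using \<open>finite T\<close> by (intro sum.Int_Diff) (simp add: T'_def)
      also have "sum u (T' \<inter> Hs) \<le> g (F \<inter> Fs)"
        using TF s by (intro u_le) (auto simp: T'_def Ebuys_def)
      also have "sum u (T' - Hs) \<le> cap (T' - Hs)"
      proof (rule sum_mono)
        fix k assume "k \<in> T' - Hs"
        then have "k \<in> N" "k \<in> N - {i} - Hs" using TF by (auto simp: T'_def)
        then show "u k \<le> real_of_ereal (D k)"
          using yD[of k] s(4)[of k] D_nonneg[of k] by (cases "D k") (auto simp: u_def)
      qed
      finally have "sum u T \<le> g (F \<inter> Fs) + cap (T' - Hs)" by simp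
      moreover have "g Fs + cap (T' - Hs) + \<delta> \<le> g (F \<union> Fs)"
        using TF s True by (intro \<delta>_L) (auto simp: T'_def R_def Ebuys_def)
      moreover have "g (F \<union> Fs) + g (F \<inter> Fs) \<le> g F + g Fs"
        using TF s by (intro submod)
      ultimately show ?thesis using True by (simp add: g2_def)
    qed
  qed
  then obtain y2 where y2: "nonneg_on E y2" "\<And>F. F \<subseteq> E \<Longrightarrow> sum y2 F \<le> g2 F"
    "\<And>k. k \<in> N \<Longrightarrow> sum y2 (Ebuy E k) = u k" by blast
  have y2_i: "y2 e' = 0" if "e' \<in> Ebuy E i" for e'
  proof -
    have "sum y2 (Ebuy E i) = 0" using y2(3)[OF iN] by (simp add: u_def)
    then show ?thesis
      using that finite_sub(1)[OF Ebuy_subset] nonneg_on_ge0[OF y2(1)] by (simp add: sum_nonneg_eq_0_iff)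
  qed
  define z where "z = (\<lambda>e'. y2 e' + (if e' = e then \<delta> else 0))"
  have z_sum: "sum z F = sum y2 F + (if e \<in> F then \<delta> else 0)" if "F \<subseteq> E" for F
    using finite_sub(1)[OF that] by (simp add: z_def sum.distrib)
  have z_buy: "sum z (Ebuy E k) = (if k = i then \<delta> else sum y (Ebuy E k))" if "k \<in> N" for k
  proof -
    have "e \<in> Ebuy E k \<longleftrightarrow> k = i" using eE by (auto simp: Ebuy_def)
    then show ?thesis
      using y2(3)[OF that] by (simp add: z_sum[OF Ebuy_subset] u_def)
  qed
  have "feasible E N g D z"
    unfolding feasible_def
  proof (intro conjI allI impI ballI)
    show "nonneg_on E z" using y2(1) eE \<delta>_pos by (auto simp: nonneg_on_def z_def)
    show "sum z F \<le> g F" if "F \<subseteq> E" for F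
      using y2(2)[OF that] z_sum[OF that] by (simp add: g2_def)
    show "ereal (sum z (Ebuy E k)) \<le> D k" if "k \<in> N" for k
      using yD[OF that] \<delta>_D z_buy[OF that] by simp
  qed
  moreover have "\<forall>e'\<in>Ebuy E i. z e' = (if e' = e then \<delta> else 0)"
    using y2_i by (simp add: z_def)
  moreover have "\<forall>k\<in>N - {i}. sum z (Ebuy E k) = sum y (Ebuy E k)"
    using z_buy by simp
  ultimately show False using ynot by blast
qed

end

section \<open>The effect of clinching and of a price increase on the rank\<close>

text \<open>The assumption \<open>swap\<close> is the content of
  \<open>P\<^sup>i(\<xi>) = P\<^sup>i(0)\<close>: whatever totals the other buyers can reach, they
  can still reach when \<open>i\<close> takes exactly \<open>xi\<close>. The primed data describe
  the state after \<open>xi\<close> is handed over.\<close>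

locale clinching = residual +
  fixes i :: nat and xi :: "edge \<Rightarrow> real"
  assumes iN: "i \<in> N" and xi_nonneg: "nonneg_on (Ebuy E i) xi"
    and swap: "\<And>y. feasible E N g D y \<Longrightarrow> \<exists>z. feasible E N g D z \<and>
      (\<forall>e\<in>Ebuy E i. z e = xi e) \<and> (\<forall>k\<in>N - {i}. sum z (Ebuy E k) = sum y (Ebuy E k))"
begin

definition amount :: real where "amount = sum xi (Ebuy E i)"
definition g' :: "edge set \<Rightarrow> real" where "g' F = g F - sum xi F"
definition D' :: "nat \<Rightarrow> ereal" where "D' = D(i := D i - ereal amount)"

lemma xi_ge0: "0 \<le> xi e"
  using xi_nonneg by (rule nonneg_on_ge0)

lemma amount_nonneg: "0 \<le> amount"
  unfolding amount_def by (intro sum_nonneg) (simp add: xi_ge0)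

lemma xi_outside: "e \<notin> Ebuy E i \<Longrightarrow> xi e = 0"
  using xi_nonneg unfolding nonneg_on_def by blast

lemma sum_xi: "F \<subseteq> E \<Longrightarrow> sum xi F = sum xi (F \<inter> Ebuy E i)"
  using finite_sub xi_outside by (intro sum.mono_neutral_right) auto

lemma sum_xi_all: "F \<subseteq> E \<Longrightarrow> Ebuy E i \<subseteq> F \<Longrightarrow> sum xi F = amount"
  using sum_xi[of F] by (simp add: amount_def Int_absorb1)

lemma sum_xi_buy: "sum xi (Ebuy E k) = (if k = i then amount else 0)"
proof (cases "k = i")
  case False
  then have "Ebuy E k \<inter> Ebuy E i = {}" by (auto simp: Ebuy_def)
  then show ?thesis using sum_xi[OF Ebuy_subset] False by simp
qed (simp add: amount_def)

lemma feasible_zero: "feasible E N g D (\<lambda>_. 0)"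
  using g_nonneg D_nonneg by (simp add: feasible_def nonneg_on_def flip: zero_ereal_def)

lemma feasible_over_xi:
  obtains z where "feasible E N g D z" "\<And>e. e \<in> Ebuy E i \<Longrightarrow> z e = xi e"
  using swap[OF feasible_zero] by blast

lemma amount_le: "ereal amount \<le> D i"
proof -
  obtain z where z: "feasible E N g D z" "\<And>e. e \<in> Ebuy E i \<Longrightarrow> z e = xi e"
    using feasible_over_xi by blast
  then have "sum z (Ebuy E i) = amount" by (simp add: amount_def)
  then show ?thesis using z(1) iN by (auto simp: feasible_def)
qed

lemma sum_xi_le: "F \<subseteq> E \<Longrightarrow> sum xi F \<le> g F"
proof -
  assume F: "F \<subseteq> E"
  obtain z where z: "feasible E N g D z" "\<And>e. e \<in> Ebuy E i \<Longrightarrow> z e = xi e"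
    using feasible_over_xi by blast
  have "xi e \<le> z e" for e
    using z xi_outside[of e] nonneg_on_ge0[of E z e] by (cases "e \<in> Ebuy E i") (auto simp: feasible_def)
  then have "sum xi F \<le> sum z F" by (intro sum_mono)
  also have "\<dots> \<le> g F" using z(1) F by (simp add: feasible_def)
  finally show ?thesis .
qed

lemma residual_post: "residual E N g' D'"
proof
  fix F G assume FG: "F \<subseteq> E" "G \<subseteq> E"
  have "sum xi (F \<union> G) + sum xi (F \<inter> G) = sum xi F + sum xi G"
    using FG finite_sub by (intro sum.union_inter)
  then show "g' (F \<union> G) + g' (F \<inter> G) \<le> g' F + g' G"
    using submod[OF FG] by (simp add: g'_def)
next
  fix k assume "k \<in> N"
  then show "0 \<le> D' k"
    using D_nonneg[of k] amount_le by (cases "D i") (auto simp: D'_def)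
qed (use finE finN E_N g_empty sum_xi_le in \<open>auto simp: g'_def\<close>)

lemma D'_other [simp]: "k \<noteq> i \<Longrightarrow> D' k = D k"
  by (simp add: D'_def)

lemma real_D'_i: "D i \<noteq> \<infinity> \<Longrightarrow> real_of_ereal (D' i) = real_of_ereal (D i) - amount"
  using D_nonneg[OF iN] by (cases "D i") (auto simp: D'_def)

lemma D'_inf: "D' k = \<infinity> \<longleftrightarrow> D k = \<infinity>"
  by (cases "D i") (auto simp: D'_def)

lemma feasible_subtract_xi:
  assumes z: "feasible E N g D z" "\<And>e. e \<in> Ebuy E i \<Longrightarrow> z e = xi e"
  shows "feasible E N g' D' (\<lambda>e. z e - xi e)"
  unfolding feasible_def
proof (intro conjI allI impI ballI)
  show "nonneg_on E (\<lambda>e. z e - xi e)"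
    unfolding nonneg_on_def
    using z xi_outside Ebuy_subset[of E i] by (smt (verit) feasible_def nonneg_on_def subsetD)
  show "sum (\<lambda>e. z e - xi e) F \<le> g' F" if "F \<subseteq> E" for F
    using z(1) that by (simp add: feasible_def sum_subtractf g'_def)
  show "ereal (sum (\<lambda>e. z e - xi e) (Ebuy E k)) \<le> D' k" if "k \<in> N" for k
  proof (cases "k = i")
    case True
    then have "sum (\<lambda>e. z e - xi e) (Ebuy E k) = 0" using z(2) by simp
    then show ?thesis
      using residual.D_nonneg[OF residual_post that] by (simp add: zero_ereal_def)
  next
    case False
    then show ?thesis
      using z(1) that by (simp add: sum_subtractf sum_xi_buy feasible_def)
  qed
qed

lemma feasible_add_xi:
  assumes z: "feasible E N g' D' z"
  shows "feasible E N g D (\<lambda>e. z e + xi e)"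
  unfolding feasible_def
proof (intro conjI allI impI ballI)
  show "nonneg_on E (\<lambda>e. z e + xi e)"
    using z xi_nonneg nonneg_on_mono[OF Ebuy_subset] by (auto simp: feasible_def intro: nonneg_on_add)
  show "sum (\<lambda>e. z e + xi e) F \<le> g F" if "F \<subseteq> E" for F
  proof -
    have "sum z F \<le> g' F" using z that by (simp add: feasible_def)
    then show ?thesis by (simp add: sum.distrib g'_def)
  qed
  show "ereal (sum (\<lambda>e. z e + xi e) (Ebuy E k)) \<le> D k" if "k \<in> N" for k
  proof (cases "k = i")
    case True
    have "ereal (sum z (Ebuy E k)) \<le> D' k" using z that by (simp add: feasible_def)
    then show ?thesis
      using True by (cases "D i") (auto simp: D'_def sum.distrib amount_def)
  next
    case False
    have "ereal (sum z (Ebuy E k)) \<le> D' k" using z that by (simp add: feasible_def)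
    then show ?thesis
      using False by (simp add: sum.distrib sum_xi_buy)
  qed
qed

text \<open>Take a feasible vector that is optimal for \<open>S\<close>, exchange it by
  \<open>swap\<close> for one in which \<open>i\<close> holds \<open>xi\<close>, and subtract
  \<open>xi\<close>. The totals on \<open>S\<close> are untouched.\<close>

lemma rk_post_outside:
  assumes "S \<subseteq> N" "i \<notin> S"
  shows "rk S \<le> rank_fn E g' D' S"
proof -
  obtain y where y: "feasible E N g D y" "(\<Sum>k\<in>S. sum y (Ebuy E k)) = rk S"
    using strong_duality[OF assms(1)] .
  obtain z where z: "feasible E N g D z" "\<And>e. e \<in> Ebuy E i \<Longrightarrow> z e = xi e"
    "\<And>k. k \<in> N - {i} \<Longrightarrow> sum z (Ebuy E k) = sum y (Ebuy E k)"
    using swap[OF y(1)] by blast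
  have "rk S = (\<Sum>k\<in>S. sum (\<lambda>e. z e - xi e) (Ebuy E k))"
    unfolding y(2)[symmetric]
  proof (rule sum.cong[OF refl])
    fix k assume "k \<in> S"
    then have "k \<in> N - {i}" "k \<noteq> i" using assms by auto
    then show "sum y (Ebuy E k) = sum (\<lambda>e. z e - xi e) (Ebuy E k)"
      unfolding sum_subtractf sum_xi_buy using z(3) by simp
  qed
  also have "\<dots> \<le> rank_fn E g' D' S"
    using residual.weak_duality[OF residual_post feasible_subtract_xi[OF z(1,2)] assms(1)] by simp
  finally show ?thesis .
qed

text \<open>This is why clinching cannot lower the potential: the rank loses at most what
  \<open>i\<close> gains. If an optimal pair after clinching has \<open>i\<close> in
  \<open>H\<close>, then \<open>F\<close> contains all of \<open>xi\<close> and the values differ by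
  \<open>amount\<close>. Otherwise \<open>i\<close> is capped, her cap has dropped by
  \<open>amount\<close>, and the rest follows from \<open>rk_post_outside\<close> for
  \<open>S - {i}\<close>.\<close>

lemma rk_post_ge:
  assumes S: "S \<subseteq> N"
  shows "rk S - (if i \<in> S then amount else 0) \<le> rank_fn E g' D' S"
proof (cases "i \<in> S")
  case False
  then show ?thesis using rk_post_outside S by simp
next
  case True
  interpret post: residual E N g' D' by (rule residual_post)
  obtain F H where FH: "F \<subseteq> E" "H \<subseteq> S" "Ebuys E H \<subseteq> F" "\<And>k. k \<in> S - H \<Longrightarrow> D' k \<noteq> \<infinity>"
    "post.rk S = g' F + post.cap (S - H)"
    using post.rk_attained[OF S] by blast
  show ?thesis
  proof (cases "i \<in> H")
    case iH: True
    then have "Ebuy E i \<subseteq> F" using FH(3) by (auto simp: Ebuys_def Ebuy_def)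
    then have "g' F = g F - amount" using sum_xi_all FH(1) by (simp add: g'_def)
    moreover have "post.cap (S - H) = cap (S - H)"
      using iH by (intro sum.cong refl) (auto simp: D'_def)
    moreover have "rk S \<le> g F + cap (S - H)"
      using S FH by (intro rk_le) (auto simp: D'_inf)
    ultimately show ?thesis using True FH(5) by simp
  next
    case iH: False
    then have Di: "D i \<noteq> \<infinity>" using FH(4)[of i] True by (simp add: D'_inf)
    have "post.cap (S - H) = real_of_ereal (D' i) + post.cap (S - H - {i})"
      using True iH S finite_sub by (intro sum.remove) auto
    moreover have "S - H - {i} = S - {i} - H" by auto
    moreover have "post.rk (S - {i}) \<le> g' F + post.cap (S - {i} - H)"
      using S FH(1-3) iH FH(4) by (intro post.rk_le) blast+
    moreover have "rk (S - {i}) \<le> post.rk (S - {i})"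
      using S by (intro rk_post_outside) auto
    moreover have "rk S \<le> rk (S - {i}) + real_of_ereal (D i)"
      using S True Di by (rule rk_remove_le)
    ultimately show ?thesis using FH(5) True real_D'_i[OF Di] by simp
  qed
qed

text \<open>An optimal pair before clinching stays admissible and loses at least
  \<open>amount\<close>, through the edges of \<open>i\<close> or through her cap. Together with
  \<open>rk_post_ge\<close> for \<open>N - {k}\<close>, this keeps the equality of ranks for another
  buyer \<open>k\<close> intact.\<close>

lemma rk_post_all: "rank_fn E g' D' N \<le> rk N - amount"
proof -
  interpret post: residual E N g' D' by (rule residual_post)
  obtain F H where FH: "F \<subseteq> E" "H \<subseteq> N" "Ebuys E H \<subseteq> F" "\<And>k. k \<in> N - H \<Longrightarrow> D k \<noteq> \<infinity>"
    "rk N = g F + cap (N - H)"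
    using rk_attained by blast
  have *: "post.rk N \<le> g' F + post.cap (N - H)"
    using FH by (intro post.rk_le) (auto simp: D'_inf)
  show ?thesis
  proof (cases "i \<in> H")
    case iH: True
    then have "Ebuy E i \<subseteq> F" using FH(3) by (auto simp: Ebuys_def Ebuy_def)
    then have "g' F = g F - amount" using sum_xi_all FH(1) by (simp add: g'_def)
    moreover have "post.cap (N - H) = cap (N - H)"
      using iH by (intro sum.cong refl) (auto simp: D'_def)
    ultimately show ?thesis using * FH(5) by simp
  next
    case False
    have "finite (N - H)" "i \<in> N - H"
      using False iN finN by auto
    then have "post.cap (N - H) = real_of_ereal (D' i) + post.cap (N - H - {i})"
      "cap (N - H) = real_of_ereal (D i) + cap (N - H - {i})"
      by (rule sum.remove)+
    moreover have "post.cap (N - H - {i}) = cap (N - H - {i})"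
      by (intro sum.cong refl) auto
    moreover have "real_of_ereal (D' i) = real_of_ereal (D i) - amount"
      using False iN FH(4) by (intro real_D'_i) auto
    moreover have "g' F \<le> g F"
      using xi_ge0 by (simp add: g'_def sum_nonneg)
    ultimately show ?thesis using * FH(5) by simp
  qed
qed

end

text \<open>Look at an optimal pair for the new demand. If \<open>l\<close> is on the edge side, it
  was admissible with the same value before. If \<open>l\<close> is capped, its value is
  \<open>d\<close> plus that of a pair for \<open>S - {l}\<close>.\<close>

lemma (in residual) rk_price_step:
  assumes S: "S \<subseteq> N" "l \<in> S" and d: "0 \<le> d"
  shows "rk S \<le> rank_fn E g (D(l := d)) S \<or>
         (d \<noteq> \<infinity> \<and> rk (S - {l}) + real_of_ereal d \<le> rank_fn E g (D(l := d)) S)"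
proof -
  interpret new: residual E N g "D(l := d)"
    by unfold_locales (use finE finN E_N submod g_empty g_nonneg D_nonneg d in auto)
  obtain F H where FH: "F \<subseteq> E" "H \<subseteq> S" "Ebuys E H \<subseteq> F"
    "\<And>k. k \<in> S - H \<Longrightarrow> (D(l := d)) k \<noteq> \<infinity>" "new.rk S = g F + new.cap (S - H)"
    using new.rk_attained[OF S(1)] by blast
  show ?thesis
  proof (cases "l \<in> H")
    case True
    have "new.cap (S - H) = cap (S - H)"
      using True by (intro sum.cong refl) auto
    moreover have "D k \<noteq> \<infinity>" if "k \<in> S - H" for k
      using FH(4)[OF that] that True by (cases "k = l") auto
    then have "rk S \<le> g F + cap (S - H)"
      using FH S by (intro rk_le)
    ultimately show ?thesis using FH(5) by simp
  next
    case False
    have "new.cap (S - H) = real_of_ereal d + new.cap (S - H - {l})"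
      using False S finite_sub by (subst sum.remove[of _ l]) auto
    also have "new.cap (S - H - {l}) = cap (S - {l} - H)"
      by (rule sum.cong) auto
    finally have "new.cap (S - H) = real_of_ereal d + cap (S - {l} - H)" .
    moreover have "D k \<noteq> \<infinity>" if "k \<in> S - {l} - H" for k
      using FH(4)[of k] that by auto
    then have "rk (S - {l}) \<le> g F + cap (S - {l} - H)"
      using FH S False by (intro rk_le) auto
    moreover have "d \<noteq> \<infinity>" using FH(4)[of l] False S by auto
    ultimately show ?thesis using FH(5) by simp
  qed
qed

lemma (in residual) rk_price_step_outside:
  "l \<notin> S \<Longrightarrow> rank_fn E g (D(l := d)) S = rk S"
proof -
  assume l: "l \<notin> S"
  then have "duals E (D(l := d)) S = duals E D S"
    by (auto simp: duals_def)
  moreover have "dual_value g (D(l := d)) S = dual_value g D S"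
    using l by (auto simp: dual_value_def fun_eq_iff intro!: sum.cong)
  ultimately show ?thesis by (simp add: rank_fn_def)
qed

section \<open>The modified market\<close>

locale market_model =
  fixes M :: market
  assumes E0_sub: "E0 M \<subseteq> {1..nb M} \<times> {1..ms M}"
    and f_empty: "\<forall>j\<in>{1..ms M}. fs M j {} = 0"
    and f_mono: "\<forall>j\<in>{1..ms M}. \<forall>F G. F \<subseteq> G \<and> G \<subseteq> Esel (E0 M) j \<longrightarrow> fs M j F \<le> fs M j G"
    and f_submod: "\<forall>j\<in>{1..ms M}. \<forall>F G. F \<subseteq> Esel (E0 M) j \<and> G \<subseteq> Esel (E0 M) j \<longrightarrow>
                     fs M j (F \<union> G) + fs M j (F \<inter> G) \<le> fs M j F + fs M j G"
    and v_pos: "\<forall>i\<in>{1..nb M}. 0 < val M i"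
    and B_nonneg: "\<forall>i\<in>{1..nb M}. 0 \<le> bud M i"
    and rho_pos: "\<forall>j\<in>{1..ms M}. 0 < rho M j"
begin

abbreviation "E \<equiv> Emod M"
abbreviation "N \<equiv> allN M"
abbreviation "f \<equiv> fN M"
abbreviation "v \<equiv> vm M"

lemma finite_N: "finite N"
  by (simp add: allN_def)

lemma finite_E: "finite E"
proof -
  have "finite (E0 M)"
    using E0_sub by (rule finite_subset) simp
  moreover have "{(nb M + j, j) | j. j \<in> {1..ms M}} = (\<lambda>j. (nb M + j, j)) ` {1..ms M}"
    by auto
  ultimately show ?thesis
    by (simp add: Emod_def)
qed

lemma fst_E: "fst ` E \<subseteq> N"
  using E0_sub by (auto simp: Emod_def allN_def)

lemma vm_pos: "k \<in> N \<Longrightarrow> 0 < v k"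
proof (cases "k \<le> nb M")
  case False
  assume "k \<in> N"
  then have "k - nb M \<in> {1..ms M}" using False by (auto simp: allN_def)
  then show ?thesis using rho_pos False by (simp add: vm_def)
qed (use v_pos in \<open>simp add: allN_def vm_def\<close>)

lemma Bm_nonneg: "k \<in> N \<Longrightarrow> 0 \<le> Bm M k"
  using B_nonneg by (auto simp: allN_def Bm_def)

lemma Esel_remove:
  "F \<subseteq> Esel E j \<Longrightarrow> (nb M + j, j) \<notin> F \<Longrightarrow> F \<subseteq> Esel (E0 M) j"
  by (auto simp: Esel_def Emod_def)

lemma fext_empty: "j \<in> {1..ms M} \<Longrightarrow> fext M j {} = 0"
  using f_empty by (simp add: fext_def)

lemma fext_mono:
  assumes "j \<in> {1..ms M}" "F \<subseteq> G" "G \<subseteq> Esel E j"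
  shows "fext M j F \<le> fext M j G"
proof (cases "(nb M + j, j) \<in> G")
  case True
  then show ?thesis
    using assms f_mono Esel_remove[of F j] by (auto simp: fext_def)
next
  case False
  then have "G \<subseteq> Esel (E0 M) j" "(nb M + j, j) \<notin> F"
    using assms Esel_remove by auto
  then show ?thesis using False assms f_mono by (simp add: fext_def)
qed

text \<open>If exactly one of the sets contains the virtual edge, it and the union both have the
  full value, and monotonicity settles the rest.\<close>

lemma fext_submod:
  assumes j: "j \<in> {1..ms M}" and FG: "F \<subseteq> Esel E j" "G \<subseteq> Esel E j"
  shows "fext M j (F \<union> G) + fext M j (F \<inter> G) \<le> fext M j F + fext M j G"
proof (cases "(nb M + j, j) \<in> F"; cases "(nb M + j, j) \<in> G")
  assume "(nb M + j, j) \<in> F" "(nb M + j, j) \<notin> G"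
  then show ?thesis
    using fext_mono[OF j, of "F \<inter> G" G] FG by (simp add: fext_def)
next
  assume "(nb M + j, j) \<notin> F" "(nb M + j, j) \<in> G"
  then show ?thesis
    using fext_mono[OF j, of "F \<inter> G" F] FG by (simp add: fext_def)
next
  assume "(nb M + j, j) \<notin> F" "(nb M + j, j) \<notin> G"
  then show ?thesis
    using f_submod j Esel_remove FG by (simp add: fext_def)
qed (simp add: fext_def)

lemma f_empty_set: "f {} = 0"
  using fext_empty by (simp add: fN_def)

lemma f_mono_set: "F \<subseteq> G \<Longrightarrow> f F \<le> f G"
  unfolding fN_def by (intro sum_mono fext_mono) auto

lemma f_nonneg_set: "0 \<le> f F"
  using f_mono_set[of "{}" F] f_empty_set by simp

lemma f_submod_set: "f (F \<union> G) + f (F \<inter> G) \<le> f F + f G"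
proof -
  have "fext M j ((F \<union> G) \<inter> Esel E j) + fext M j ((F \<inter> G) \<inter> Esel E j)
      \<le> fext M j (F \<inter> Esel E j) + fext M j (G \<inter> Esel E j)" if "j \<in> {1..ms M}" for j
  proof -
    have "(F \<union> G) \<inter> Esel E j = (F \<inter> Esel E j) \<union> (G \<inter> Esel E j)"
      "(F \<inter> G) \<inter> Esel E j = (F \<inter> Esel E j) \<inter> (G \<inter> Esel E j)" by auto
    then show ?thesis using fext_submod[OF that] by simp
  qed
  then show ?thesis
    unfolding fN_def sum.distrib[symmetric] by (rule sum_mono)
qed

lemma f_single:
  assumes "j \<in> {1..ms M}" "F \<subseteq> Esel E j"
  shows "f F = fext M j F"
proof -
  have "fext M j' (F \<inter> Esel E j') = (if j' = j then fext M j F else 0)" if "j' \<in> {1..ms M}" for j'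
  proof (cases "j' = j")
    case True
    then show ?thesis using assms by (simp add: Int_absorb2)
  next
    case False
    then have "F \<inter> Esel E j' = {}" using assms by (auto simp: Esel_def)
    then show ?thesis using False fext_empty[OF that] by simp
  qed
  then have "f F = (\<Sum>j'\<in>{1..ms M}. if j' = j then fext M j F else 0)"
    unfolding fN_def by (rule sum.cong[OF refl])
  then show ?thesis using assms by simp
qed

text \<open>Each edge belongs to exactly one seller, so the sellers' constraints add up to those of
  \<open>f\<close>, while \<open>f\<close> agrees with \<open>fext M j\<close> on the edges of
  \<open>j\<close>. This brings \<open>P\<close> into the form of
  \<open>aggregate_realization\<close>.\<close>

lemma inP_iff: "inP M w \<longleftrightarrow> nonneg_on E w \<and> (\<forall>F. F \<subseteq> E \<longrightarrow> sum w F \<le> f F)"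
proof
  assume w: "inP M w"
  have "sum w F \<le> f F" if F: "F \<subseteq> E" for F
  proof -
    have "finite F" using F finite_E finite_subset by blast
    moreover have "F = (\<Union>j\<in>{1..ms M}. F \<inter> Esel E j)"
      using F E0_sub by (fastforce simp: Esel_def Emod_def)
    moreover have "(F \<inter> Esel E j) \<inter> (F \<inter> Esel E j') = {}" if "j \<noteq> j'" for j j'
      using that by (auto simp: Esel_def)
    ultimately have "sum w F = (\<Sum>j\<in>{1..ms M}. sum w (F \<inter> Esel E j))"
      using sum.UNION_disjoint[of "{1..ms M}" "\<lambda>j. F \<inter> Esel E j" w] by simp
    also have "\<dots> \<le> f F"
      unfolding fN_def using w by (intro sum_mono) (simp add: inP_def)
    finally show ?thesis .
  qed
  then show "nonneg_on E w \<and> (\<forall>F. F \<subseteq> E \<longrightarrow> sum w F \<le> f F)"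
    using w by (simp add: inP_def)
next
  assume w: "nonneg_on E w \<and> (\<forall>F. F \<subseteq> E \<longrightarrow> sum w F \<le> f F)"
  have "sum w F \<le> fext M j F" if "j \<in> {1..ms M}" "F \<subseteq> Esel E j" for j F
  proof -
    have "F \<subseteq> E" using that by (auto simp: Esel_def)
    then have "sum w F \<le> f F" using w by blast
    then show ?thesis by (simp only: f_single[OF that])
  qed
  then show "inP M w" using w by (simp add: inP_def)
qed

section \<open>The greedy vector and optimal liquid welfare\<close>

text \<open>The last clause is the optimality certificate: a buyer who stays below her budget lies
  in a tight set consisting of herself and buyers of higher priority.\<close>

definition greedy_upto :: "nat set \<Rightarrow> (nat \<Rightarrow> real) \<Rightarrow> bool" where
  "greedy_upto S x \<longleftrightarrow>
     (\<forall>k\<in>S. 0 \<le> x k) \<and> (\<forall>k\<in>S. ereal (v k * x k) \<le> Bm M k) \<and>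
     (\<forall>T. T \<subseteq> S \<longrightarrow> sum x T \<le> f (Ebuys E T)) \<and>
     (\<forall>k\<in>S. ereal (v k * x k) = Bm M k \<or>
        (\<exists>T. T \<subseteq> Hset M k \<and> sum x (insert k T) = f (Ebuys E (insert k T))))"

text \<open>If the budget of \<open>i\<close> does not bind, a minimizing \<open>H\<close> makes
  \<open>insert i H\<close> tight. Earlier tight sets survive because \<open>i\<close> does not
  precede any buyer of \<open>S\<close>.\<close>

lemma greedy_upto_step:
  assumes x: "greedy_upto S x" and i: "i \<in> N" "Hset M i = S"
  shows "greedy_upto (insert i S) (xstar_step M x i)"
proof -
  have iS: "i \<notin> S" and SN: "S \<subseteq> N"
    using i(2) by (auto simp: Hset_def)
  have finS: "finite S" using SN finite_N finite_subset by blast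
  define Q where "Q = {f (Ebuys E (H \<union> {i})) - sum x H | H. H \<subseteq> S}"
  have "Q = (\<lambda>H. f (Ebuys E (H \<union> {i})) - sum x H) ` Pow S"
    by (auto simp: Q_def)
  then have finQ: "finite Q" and neQ: "Q \<noteq> {}" using finS by auto
  have m_le: "Min Q \<le> f (Ebuys E (insert i H)) - sum x H" if "H \<subseteq> S" for H
  proof -
    have "f (Ebuys E (H \<union> {i})) - sum x H \<in> Q" using that by (auto simp: Q_def)
    then show ?thesis using finQ by simp
  qed
  obtain H where H: "H \<subseteq> S" "Min Q = f (Ebuys E (insert i H)) - sum x H"
    using Min_in[OF finQ neQ] by (auto simp: Q_def)
  have "sum x H \<le> f (Ebuys E H)" using x H(1) by (simp add: greedy_upto_def)
  also have "\<dots> \<le> f (Ebuys E (insert i H))" by (intro f_mono_set Ebuys_mono) auto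
  finally have m0: "0 \<le> Min Q" using H by simp
  define t where "t = real_of_ereal (min (Bm M i / ereal (v i)) (ereal (Min Q)))"
  have vi: "0 < v i" using i vm_pos by blast
  have t: "0 \<le> t" "t \<le> Min Q" "ereal (v i * t) \<le> Bm M i" "ereal (v i * t) = Bm M i \<or> t = Min Q"
  proof -
    have "0 \<le> t \<and> t \<le> Min Q \<and> ereal (v i * t) \<le> Bm M i \<and> (ereal (v i * t) = Bm M i \<or> t = Min Q)"
    proof (cases "Bm M i")
      case (real b)
      then have b: "0 \<le> b" using Bm_nonneg[OF i(1)] by simp
      have "t = min (b / v i) (Min Q)"
        using vi real by (simp add: t_def min_def)
      then show ?thesis using b vi m0 real by (auto simp: min_def field_simps)
    next
      case PInf
      then show ?thesis using vi m0 by (simp add: t_def)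
    next
      case MInf
      then show ?thesis using Bm_nonneg[OF i(1)] by simp
    qed
    then show "0 \<le> t" "t \<le> Min Q" "ereal (v i * t) \<le> Bm M i" "ereal (v i * t) = Bm M i \<or> t = Min Q"
      by auto
  qed
  define z where "z = xstar_step M x i"
  have z: "z = x(i := t)"
    by (simp add: z_def xstar_step_def t_def Q_def i(2))
  have z_out: "sum z T = sum x T" if "i \<notin> T" for T
    using that z by (auto intro: sum.cong)
  have z_in: "sum z (insert i T) = t + sum x T" if "T \<subseteq> S" for T
  proof -
    have "finite T" "i \<notin> T" using that finS iS finite_subset by auto
    then show ?thesis using z_out[of T] z by simp
  qed
  have "sum z T \<le> f (Ebuys E T)" if T: "T \<subseteq> insert i S" for T
  proof (cases "i \<in> T")
    case True
    have "T - {i} \<subseteq> S" using T by auto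
    from m_le[OF this] z_in[OF this] show ?thesis using t(2) True by (simp add: insert_absorb)
  next
    case False
    then show ?thesis using T x z_out by (auto simp: greedy_upto_def subset_insert)
  qed
  moreover have "ereal (v k * z k) = Bm M k \<or>
        (\<exists>T. T \<subseteq> Hset M k \<and> sum z (insert k T) = f (Ebuys E (insert k T)))" if k: "k \<in> insert i S" for k
  proof (cases "k = i")
    case True
    then show ?thesis
      using t(4) H i(2) z z_in[OF H(1)] by auto
  next
    case False
    then have kS: "k \<in> S" using k by auto
    then have "k \<in> Hset M i" by (simp only: i(2))
    then have "i \<notin> Hset M k" by (auto simp: Hset_def)
    then have "sum z (insert k T) = sum x (insert k T)" if "T \<subseteq> Hset M k" for T
      using that False by (intro z_out) auto
    then show ?thesis
      using x kS False unfolding greedy_upto_def z by auto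
  qed
  ultimately show ?thesis
    using x t(1,3) iS unfolding greedy_upto_def z_def[symmetric] by (auto simp: z)
qed

section \<open>The greedy vector along the priority order and its optimality\<close>

lemma order_list: "set (order_list M) = N" "distinct (order_list M)"
  "sorted (map (\<lambda>i. (- v i, i)) (order_list M))"
  by (auto simp: order_list_def allN_def)

lemma Hset_prefix:
  assumes "order_list M = L1 @ i # L2"
  shows "Hset M i = set L1"
proof -
  have s: "\<And>a. a \<in> set L1 \<Longrightarrow> (- v a, a) \<le> (- v i, i)" "\<And>b. b \<in> set L2 \<Longrightarrow> (- v i, i) \<le> (- v b, b)"
    using order_list(3) unfolding assms by (auto simp: sorted_append)
  have "i \<notin> set L1" "set L1 \<union> insert i (set L2) = N"
    using order_list(1,2) unfolding assms by auto
  note N = this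
  show ?thesis
  proof (intro equalityI subsetI)
    fix k assume "k \<in> Hset M i"
    then have k: "k \<in> N" "v k > v i \<or> (v k = v i \<and> k < i)" by (auto simp: Hset_def)
    then have "\<not> (- v i, i) \<le> (- v k, k)" by (auto simp: less_eq_prod_def)
    then have "k \<notin> set L2" "k \<noteq> i" using s(2) by auto
    then show "k \<in> set L1" using k(1) N(2) by blast
  next
    fix k assume k: "k \<in> set L1"
    then have "k \<in> N" "k \<noteq> i" using N by auto
    then show "k \<in> Hset M i"
      using s(1)[OF k] by (auto simp: Hset_def less_eq_prod_def)
  qed
qed

lemma greedy_upto_prefix:
  "order_list M = L1 @ L2 \<Longrightarrow> greedy_upto (set L1) (foldl (xstar_step M) (\<lambda>_. 0) L1)"
proof (induction L1 arbitrary: L2 rule: rev_induct)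
  case Nil
  then show ?case using f_empty_set by (simp add: greedy_upto_def)
next
  case (snoc i L1)
  then have "order_list M = L1 @ i # L2" by simp
  moreover from this have "i \<in> N" using order_list(1) by auto
  ultimately show ?case
    using greedy_upto_step[OF snoc.IH _ Hset_prefix] by simp
qed

lemma xstar_greedy: "greedy_upto N (xstar M)"
  using greedy_upto_prefix[of "order_list M" "[]"] order_list(1) by (simp add: xstar_def)

lemma xstar_nonneg: "k \<in> N \<Longrightarrow> 0 \<le> xstar M k"
  and xstar_budget: "k \<in> N \<Longrightarrow> ereal (v k * xstar M k) \<le> Bm M k"
  and xstar_le: "T \<subseteq> N \<Longrightarrow> sum (xstar M) T \<le> f (Ebuys E T)"
  and xstar_saturated: "k \<in> N \<Longrightarrow> ereal (v k * xstar M k) = Bm M k \<or>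
        (\<exists>T. T \<subseteq> Hset M k \<and> sum (xstar M) (insert k T) = f (Ebuys E (insert k T)))"
  using xstar_greedy unfolding greedy_upto_def by blast+

lemma xstar_tight_Un:
  assumes "A \<subseteq> N" "B \<subseteq> N" "sum (xstar M) A = f (Ebuys E A)" "sum (xstar M) B = f (Ebuys E B)"
  shows "sum (xstar M) (A \<union> B) = f (Ebuys E (A \<union> B))"
proof -
  have "finite A" "finite B" using assms finite_N finite_subset by auto
  then have "sum (xstar M) (A \<union> B) + sum (xstar M) (A \<inter> B) = sum (xstar M) A + sum (xstar M) B"
    by (rule sum.union_inter)
  moreover have "sum (xstar M) (A \<union> B) \<le> f (Ebuys E (A \<union> B))" "sum (xstar M) (A \<inter> B) \<le> f (Ebuys E (A \<inter> B))"
    using assms by (auto intro!: xstar_le)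
  moreover have "Ebuys E (A \<inter> B) = Ebuys E A \<inter> Ebuys E B" by (auto simp: Ebuys_def)
  moreover have "f (Ebuys E A \<union> Ebuys E B) + f (Ebuys E A \<inter> Ebuys E B) \<le> f (Ebuys E A) + f (Ebuys E B)"
    by (rule f_submod_set)
  ultimately show ?thesis using assms by (simp add: Ebuys_Un)
qed

text \<open>The set \<open>S\<close> is closed under higher priority, so the tight sets of its
  unsaturated members unite to a tight set \<open>U\<close> within \<open>S\<close>. On
  \<open>U\<close> no allocation exceeds \<open>xstar M\<close>, since the supply is used up; on
  \<open>S - U\<close> none does within the budgets.\<close>

lemma xstar_dominates:
  assumes S: "S \<subseteq> N" "\<And>k. k \<in> S \<Longrightarrow> Hset M k \<subseteq> S"
    and w: "inP M w" and z: "\<And>k. k \<in> S \<Longrightarrow> z k \<le> sum w (Ebuy E k)"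
      "\<And>k. k \<in> S \<Longrightarrow> ereal (v k * z k) \<le> Bm M k"
  shows "sum z S \<le> sum (xstar M) S"
proof -
  have finS: "finite S" using S finite_N finite_subset by blast
  define K where "K = {k \<in> S. ereal (v k * xstar M k) \<noteq> Bm M k}"
  have "\<exists>U. U \<subseteq> S \<and> A \<subseteq> U \<and> sum (xstar M) U = f (Ebuys E U)" if "finite A" "A \<subseteq> K" for A
    using that
  proof (induction A rule: finite_induct)
    case empty
    then show ?case using f_empty_set by (intro exI[of _ "{}"]) simp
  next
    case (insert k A)
    then obtain U where U: "U \<subseteq> S" "A \<subseteq> U" "sum (xstar M) U = f (Ebuys E U)" by auto
    have k: "k \<in> S" "k \<in> N" "ereal (v k * xstar M k) \<noteq> Bm M k" using insert.prems S by (auto simp: K_def)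
    then obtain T where T: "T \<subseteq> Hset M k" "sum (xstar M) (insert k T) = f (Ebuys E (insert k T))"
      using xstar_saturated by blast
    then have "insert k T \<subseteq> S" using S k by blast
    moreover from this have "sum (xstar M) (U \<union> insert k T) = f (Ebuys E (U \<union> insert k T))"
      using U T S(1) by (intro xstar_tight_Un) auto
    ultimately show ?case
      using U(1,2) by (intro exI[of _ "U \<union> insert k T"]) auto
  qed
  from this[of K] obtain U where U: "U \<subseteq> S" "K \<subseteq> U" "sum (xstar M) U = f (Ebuys E U)"
    using finS by (auto simp: K_def)
  have "sum z U \<le> (\<Sum>k\<in>U. sum w (Ebuy E k))"
    using U z by (intro sum_mono) auto
  also have "\<dots> = sum w (Ebuys E U)"
    using sum_Ebuys[OF finite_E] finS U finite_subset by metis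
  also have "\<dots> \<le> sum (xstar M) U"
    using w U(3) Ebuys_subset by (simp add: inP_iff)
  finally have "sum z U \<le> sum (xstar M) U" .
  moreover have "sum z (S - U) \<le> sum (xstar M) (S - U)"
  proof (rule sum_mono)
    fix k assume k: "k \<in> S - U"
    then have "ereal (v k * xstar M k) = Bm M k"
      using U(2) by (auto simp: K_def)
    then have "ereal (v k * z k) \<le> ereal (v k * xstar M k)"
      using z(2)[of k] k by simp
    moreover have "0 < v k" using k S vm_pos by auto
    ultimately show "z k \<le> xstar M k" by simp
  qed
  ultimately show ?thesis
    using sum.subset_diff[OF U(1) finS, of z] sum.subset_diff[OF U(1) finS, of "xstar M"] by linarith
qed

text \<open>Let \<open>z\<close> be the amounts truncated at the budgets, so that
  \<open>v i * z i\<close> is the liquid welfare of \<open>i\<close>. Level sets of the valuations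
  are closed under \<open>Hset\<close>, hence \<open>xstar M\<close> dominates \<open>z\<close> on
  each of them, and summation by parts applies.\<close>

lemma LW_le_xstar:
  assumes w: "inP M w"
  shows "LW M w \<le> ereal (\<Sum>i\<in>N. v i * xstar M i)"
proof -
  define a where "a = (\<lambda>i. real_of_ereal (min (ereal (v i * sum w (Ebuy E i))) (Bm M i)))"
  have a: "ereal (a i) = min (ereal (v i * sum w (Ebuy E i))) (Bm M i)" if "i \<in> N" for i
    using Bm_nonneg[OF that] by (cases "Bm M i") (auto simp: a_def min_def)
  define z where "z = (\<lambda>i. a i / v i)"
  have vz: "v i * z i = a i" if "i \<in> N" for i
    using vm_pos[OF that] by (simp add: z_def)
  have "0 \<le> (\<Sum>i\<in>N. v i * (xstar M i - z i))"
  proof (rule level_set_weighted_sum_nonneg[OF finite_N vm_pos])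
    fix \<theta>
    have "sum z {i \<in> N. \<theta> \<le> v i} \<le> sum (xstar M) {i \<in> N. \<theta> \<le> v i}"
    proof (rule xstar_dominates[OF _ _ w])
      fix k assume k: "k \<in> {i \<in> N. \<theta> \<le> v i}"
      then have kN: "k \<in> N" by simp
      show "Hset M k \<subseteq> {i \<in> N. \<theta> \<le> v i}" using k by (auto simp: Hset_def)
      have "ereal (a k) \<le> ereal (v k * sum w (Ebuy E k))" "ereal (a k) \<le> Bm M k"
        unfolding a[OF kN] by auto
      then have "v k * z k \<le> v k * sum w (Ebuy E k)" "ereal (v k * z k) \<le> Bm M k"
        unfolding vz[OF kN] by simp_all
      then show "z k \<le> sum w (Ebuy E k)" "ereal (v k * z k) \<le> Bm M k"
        using vm_pos[OF kN] by (simp_all only: mult_le_cancel_left_pos)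
    qed auto
    then show "0 \<le> (\<Sum>i\<in>{i \<in> N. \<theta> \<le> v i}. xstar M i - z i)"
      by (simp add: sum_subtractf)
  qed
  then have "(\<Sum>i\<in>N. a i) \<le> (\<Sum>i\<in>N. v i * xstar M i)"
    using vz by (simp add: right_diff_distrib sum_subtractf)
  moreover have "LW M w = ereal (\<Sum>i\<in>N. a i)"
    unfolding LW_def using a by (simp flip: sum_ereal)
  ultimately show ?thesis by simp
qed

lemma LW_OPT_xstar: "ereal (\<Sum>i\<in>N. v i * xstar M i) = LW_OPT M"
proof (rule antisym)
  have "\<exists>w. nonneg_on E w \<and> (\<forall>F. F \<subseteq> E \<longrightarrow> sum w F \<le> f F) \<and> (\<forall>k\<in>N. sum w (Ebuy E k) = xstar M k)"
  proof (rule aggregate_realization[OF finite_E finite_N fst_E f_submod_set f_empty_set xstar_nonneg])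
    fix T F assume "T \<subseteq> N" "Ebuys E T \<subseteq> F"
    then show "sum (xstar M) T \<le> f F"
      using xstar_le[of T] f_mono_set[of "Ebuys E T" F] by linarith
  qed
  then obtain w where w: "inP M w" "\<And>k. k \<in> N \<Longrightarrow> sum w (Ebuy E k) = xstar M k"
    unfolding inP_iff by blast
  have "LW M w = (\<Sum>i\<in>N. ereal (v i * xstar M i))"
    unfolding LW_def using w(2) xstar_budget by (intro sum.cong) (auto simp: min_absorb1)
  then have "LW M w = ereal (\<Sum>i\<in>N. v i * xstar M i)" by simp
  then show "ereal (\<Sum>i\<in>N. v i * xstar M i) \<le> LW_OPT M"
    unfolding LW_OPT_def using SUP_upper[of w "{w. inP M w}" "LW M"] w(1) by simp
  show "LW_OPT M \<le> ereal (\<Sum>i\<in>N. v i * xstar M i)"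
    unfolding LW_OPT_def using LW_le_xstar by (auto intro: SUP_least)
qed

end

section \<open>Runs of the auction\<close>

text \<open>Taking everything from buyer \<open>i\<close> leaves the other totals unchanged, so
  \<open>P\<^sup>i(0)\<close> contains every \<open>P\<^sup>i(\<xi>)\<close> and only the reverse
  inclusion restricts clinching.\<close>

lemma feasible_zero_out:
  assumes y: "feasible E N g D y"
  shows "feasible E N g D (\<lambda>e. if e \<in> Ebuy E i then 0 else y e)"
    (is "feasible E N g D ?y")
proof -
  have le: "?y e \<le> y e" for e
    using y by (auto simp: feasible_def intro: nonneg_on_ge0)
  then have sum_le: "sum ?y F \<le> sum y F" for F
    by (intro sum_mono)
  show ?thesis
    unfolding feasible_def
  proof (intro conjI allI impI ballI)
    show "nonneg_on E ?y"
      using y by (auto simp: feasible_def nonneg_on_def)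
    show "sum ?y F \<le> g F" if "F \<subseteq> E" for F
      using y that order_trans[OF sum_le] by (auto simp: feasible_def)
    show "ereal (sum ?y (Ebuy E k)) \<le> D k" if "k \<in> N" for k
    proof -
      have "ereal (sum ?y (Ebuy E k)) \<le> ereal (sum y (Ebuy E k))" using sum_le by simp
      also have "\<dots> \<le> D k" using y that by (simp add: feasible_def)
      finally show ?thesis .
    qed
  qed
qed

lemma sum_zero_out:
  "k \<noteq> i \<Longrightarrow> (\<Sum>e\<in>Ebuy E k. if e \<in> Ebuy E i then 0 else y e) = sum y (Ebuy E k)"
  by (rule sum.cong) (auto simp: Ebuy_def)

section \<open>Auction states and the effect of a round of clinching\<close>

context market_model
begin

definition res :: "(edge \<Rightarrow> real) \<Rightarrow> edge set \<Rightarrow> real" where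
  "res w F = f F - sum w F"

definition alloc :: "pca_state \<Rightarrow> nat \<Rightarrow> real" where
  "alloc s k = sum (wS s) (Ebuy E k)"

definition srank :: "pca_state \<Rightarrow> nat set \<Rightarrow> real" where
  "srank s = rank_fn E (res (wS s)) (dS s)"

text \<open>The last inequality says that nobody has paid more than the current price per unit,
  which persists because prices only rise.\<close>

definition good :: "pca_state \<Rightarrow> bool" where
  "good s \<longleftrightarrow> inP M (wS s) \<and> dS s = dem M v (cS s) (pS s) \<and>
     (\<forall>k\<in>N. 0 \<le> cS s k \<and> ereal (pS s k) \<le> Bm M k \<and> pS s k \<le> cS s k * alloc s k)"

lemma residual_res:
  assumes "inP M w" "\<And>k. k \<in> N \<Longrightarrow> 0 \<le> d k"
  shows "residual E N (res w) d"
proof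
  show "res w (F \<union> G) + res w (F \<inter> G) \<le> res w F + res w G" if "F \<subseteq> E" "G \<subseteq> E" for F G
  proof -
    have "finite F" "finite G" using that finite_E finite_subset by auto
    then have "sum w (F \<union> G) + sum w (F \<inter> G) = sum w F + sum w G" by (rule sum.union_inter)
    then show ?thesis using f_submod_set[of F G] by (simp add: res_def)
  qed
qed (use assms finite_E finite_N fst_E f_empty_set in \<open>auto simp: res_def inP_iff\<close>)

lemma Pwd_feasible:
  assumes "inP M w"
  shows "y \<in> Pwd M w d \<longleftrightarrow> feasible E N (res w) d y"
proof -
  have "nonneg_on E y \<Longrightarrow> nonneg_on E (\<lambda>e. w e + y e)"
    using assms by (simp add: inP_iff nonneg_on_add)
  then show ?thesis
    by (auto simp: Pwd_def feasible_def inP_iff res_def sum.distrib algebra_simps)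
qed

lemma dem_nonneg:
  assumes "k \<in> N" "0 \<le> c k" "ereal (p k) \<le> Bm M k"
  shows "0 \<le> dem M b c p k"
proof (cases "Bm M k")
  case (real r)
  then show ?thesis using assms by (auto simp: dem_def)
next
  case PInf
  then show ?thesis using assms by (auto simp: dem_def)
next
  case MInf
  then show ?thesis using assms by simp
qed

lemma good_residual: "good s \<Longrightarrow> residual E N (res (wS s)) (dS s)"
  by (intro residual_res) (auto simp: good_def intro: dem_nonneg)

lemma good_dropped: "good s \<Longrightarrow> k \<in> N \<Longrightarrow> v k \<le> cS s k \<Longrightarrow> dS s k = 0"
  using vm_pos[of k] by (auto simp: good_def dem_def)

lemma alloc_nonneg: "good s \<Longrightarrow> 0 \<le> alloc s k"
  unfolding alloc_def by (rule nonneg_on_sum_ge0[of E]) (simp add: good_def inP_iff)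

text \<open>Paying \<open>c k * a\<close> lowers a finite affordable demand by \<open>a\<close>. At
  price 0 the demand stays infinite, and a buyer who has dropped out has demand 0, which forces
  \<open>a = 0\<close>.\<close>

lemma dem_after_payment:
  assumes "k \<in> N" "0 \<le> c k" "0 \<le> a" "ereal a \<le> dem M v c p k"
  shows "dem M v c (p(k := p k + c k * a)) k = dem M v c p k - ereal a"
proof (cases "c k = 0 \<or> \<not> c k < v k")
  case True
  then show ?thesis
    using assms vm_pos[of k] by (auto simp: dem_def zero_ereal_def)
next
  case False
  then have c: "0 < c k" "c k < v k" using assms by auto
  show ?thesis
  proof (cases "Bm M k")
    case (real r)
    then show ?thesis using c by (simp add: dem_def field_simps)
  next
    case PInf
    then show ?thesis using c by (simp add: dem_def)
  next
    case MInf
    then show ?thesis using Bm_nonneg[OF assms(1)] by simp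
  qed
qed

lemma payment_within_budget:
  assumes "k \<in> N" "0 \<le> c k" "0 \<le> a" "ereal a \<le> dem M v c p k" "ereal (p k) \<le> Bm M k"
  shows "ereal (p k + c k * a) \<le> Bm M k"
proof (cases "c k = 0 \<or> \<not> c k < v k")
  case True
  then have "c k * a = 0"
    using assms vm_pos[of k] by (auto simp: dem_def zero_ereal_def)
  then have "p k + c k * a = p k" by simp
  then show ?thesis using assms(5) by (simp only:)
next
  case False
  then have c: "0 < c k" "c k < v k" using assms by auto
  show ?thesis
  proof (cases "Bm M k")
    case (real r)
    then show ?thesis using c assms by (simp add: dem_def field_simps)
  next
    case PInf
    then show ?thesis by simp
  next
    case MInf
    then show ?thesis using Bm_nonneg[OF assms(1)] by simp
  qed
qed

text \<open>A clinching step is an instance of \<open>clinching\<close>, which gives the bounds on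
  the rank. The final conclusion uses maximality of \<open>xi\<close>: no edge of \<open>i\<close>
  can carry a further positive amount, so \<open>rk_remove_unclinchable\<close> applies to the new
  state.\<close>

lemma clinch_one_effect:
  assumes good: "good s" and iN: "i \<in> N" and step: "clinch_one M v i s s'"
  obtains a where "good s'" "cS s' = cS s" "lS s' = lS s" "0 \<le> a" "ereal a \<le> dS s i"
    "\<And>k. alloc s' k = alloc s k + (if k = i then a else 0)"
    "\<And>S. S \<subseteq> N \<Longrightarrow> srank s S - (if i \<in> S then a else 0) \<le> srank s' S"
    "srank s' N \<le> srank s N - a" "srank s' N \<le> srank s' (N - {i})"
proof -
  obtain xi where max: "max_clinchable M (wS s) (dS s) i xi"
    and s': "s' = s\<lparr> wS := (\<lambda>e. wS s e + xi e),
        pS := (pS s)(i := pS s i + cS s i * sum xi (Ebuy E i)),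
        dS := dem M v (cS s) ((pS s)(i := pS s i + cS s i * sum xi (Ebuy E i))) \<rparr>"
    using step by (auto simp: clinch_one_def Let_def)
  have inP: "inP M (wS s)" and dS: "dS s = dem M v (cS s) (pS s)"
    and k_good: "\<And>k. k \<in> N \<Longrightarrow> 0 \<le> cS s k \<and> ereal (pS s k) \<le> Bm M k \<and> pS s k \<le> cS s k * alloc s k"
    using good by (auto simp: good_def)
  let ?g = "res (wS s)" and ?d = "dS s"
  have cl: "nonneg_on (Ebuy E i) xi" "Pproj M (wS s) ?d i xi = Pproj M (wS s) ?d i (\<lambda>_. 0)"
    using max by (auto simp: max_clinchable_def clinchable_def)
  note Pf = Pwd_feasible[OF inP]
  define proj where "proj y = (\<lambda>k. if k \<in> N - {i} then sum y (Ebuy E k) else 0)" for y :: "edge \<Rightarrow> real"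
  have Pproj: "u \<in> Pproj M (wS s) ?d i x \<longleftrightarrow>
      (\<exists>y. feasible E N ?g ?d y \<and> (\<forall>e\<in>Ebuy E i. y e = x e) \<and> u = proj y)" for u x
    by (auto simp: Pproj_def Pf proj_def)
  have proj_eq: "sum y (Ebuy E k) = sum z (Ebuy E k)" if "proj y = proj z" "k \<in> N - {i}" for y z k
    using fun_cong[OF that(1), of k] that(2) by (simp add: proj_def)
  have proj_0: "proj y \<in> Pproj M (wS s) ?d i (\<lambda>_. 0)" if "feasible E N ?g ?d y" for y
    unfolding Pproj
    using feasible_zero_out[OF that, of i] sum_zero_out[of _ i E y]
    by (intro exI[of _ "\<lambda>e. if e \<in> Ebuy E i then 0 else y e"]) (auto simp: proj_def fun_eq_iff)
  interpret r: residual E N ?g ?d by (rule good_residual[OF good])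
  interpret c: clinching E N ?g ?d i xi
  proof
    fix y assume "feasible E N ?g ?d y"
    then have "proj y \<in> Pproj M (wS s) ?d i xi" using proj_0 cl(2) by simp
    then show "\<exists>z. feasible E N ?g ?d z \<and> (\<forall>e\<in>Ebuy E i. z e = xi e) \<and>
        (\<forall>k\<in>N - {i}. sum z (Ebuy E k) = sum y (Ebuy E k))"
      unfolding Pproj using proj_eq by metis
  qed (use iN cl in auto)
  define a where "a = c.amount"
  have a: "a = sum xi (Ebuy E i)" by (simp add: a_def c.amount_def)
  have a0: "0 \<le> a" and aD: "ereal a \<le> dS s i"
    using c.amount_nonneg c.amount_le by (simp_all add: a_def)
  have aD': "ereal a \<le> dem M v (cS s) (pS s) i" using aD dS by simp
  have res': "res (wS s') = c.g'"
    by (auto simp: s' res_def c.g'_def sum.distrib fun_eq_iff)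
  have dS': "dS s' = c.D'"
  proof
    fix k
    show "dS s' k = c.D' k"
    proof (cases "k = i")
      case True
      have "dS s' i = dem M v (cS s) ((pS s)(i := pS s i + cS s i * a)) i"
        by (simp add: s' a)
      also have "\<dots> = dS s i - ereal a"
        unfolding dS using iN k_good a0 aD' by (intro dem_after_payment) auto
      finally show ?thesis using True by (simp add: c.D'_def a_def)
    next
      case False
      then have "dS s' k = dem M v (cS s) (pS s) k" by (simp add: s' dem_def)
      also have "\<dots> = c.D' k" unfolding dS[symmetric] using False by simp
      finally show ?thesis .
    qed
  qed
  have alloc': "alloc s' k = alloc s k + (if k = i then a else 0)" for k
    using c.sum_xi_buy[of k] by (simp add: s' alloc_def sum.distrib a_def)
  have srank': "srank s' = rank_fn E c.g' c.D'"
    by (simp add: srank_def res' dS')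
  have "good s'"
    unfolding good_def
  proof (intro conjI ballI)
    have "nonneg_on E (\<lambda>e. wS s e + xi e)"
      using inP nonneg_on_mono[OF Ebuy_subset cl(1)] by (simp add: inP_iff nonneg_on_add)
    moreover have "sum (\<lambda>e. wS s e + xi e) F \<le> f F" if "F \<subseteq> E" for F
      using c.sum_xi_le[OF that] by (simp add: res_def sum.distrib)
    ultimately show "inP M (wS s')" by (simp add: inP_iff s')
    show "dS s' = dem M v (cS s') (pS s')" by (simp add: s')
    fix k assume k: "k \<in> N"
    show "0 \<le> cS s' k" using k_good[OF k] by (simp add: s')
    show "ereal (pS s' k) \<le> Bm M k"
      using k_good[OF k] payment_within_budget[of k "cS s" a "pS s"] k a0 aD'
      by (auto simp: s' a[symmetric])
    show "pS s' k \<le> cS s' k * alloc s' k"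
      using k_good[OF k] alloc'[of k] by (auto simp: s' a[symmetric] algebra_simps)
  qed
  moreover have "srank s' N \<le> srank s' (N - {i})"
    unfolding srank'
  proof (rule residual.rk_remove_unclinchable[OF c.residual_post iN])
    fix e and \<delta> :: real assume e: "e \<in> Ebuy E i" and \<delta>: "0 < \<delta>"
    \<comment> \<open>If every feasible vector could be exchanged for one with \<delta> on
      \<open>e\<close>, then \<open>xi2\<close> would be clinchable in the old state and strictly
      above \<open>xi\<close>.\<close>
    define xi2 where "xi2 = (\<lambda>e'. xi e' + (if e' = e then \<delta> else 0))"
    show "\<exists>y. feasible E N c.g' c.D' y \<and> \<not> (\<exists>z. feasible E N c.g' c.D' z \<and>
            (\<forall>e'\<in>Ebuy E i. z e' = (if e' = e then \<delta> else 0)) \<and>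
            (\<forall>k\<in>N - {i}. sum z (Ebuy E k) = sum y (Ebuy E k)))"
    proof (rule ccontr)
      assume "\<not> ?thesis"
      then have all: "\<exists>z. feasible E N c.g' c.D' z \<and>
            (\<forall>e'\<in>Ebuy E i. z e' = (if e' = e then \<delta> else 0)) \<and>
            (\<forall>k\<in>N - {i}. sum z (Ebuy E k) = sum y (Ebuy E k))" if "feasible E N c.g' c.D' y" for y
        using that by blast
      have "Pproj M (wS s) ?d i xi2 = Pproj M (wS s) ?d i (\<lambda>_. 0)"
      proof (intro equalityI subsetI)
        fix u assume "u \<in> Pproj M (wS s) ?d i xi2"
        then obtain y where "feasible E N ?g ?d y" "u = proj y" unfolding Pproj by blast
        then show "u \<in> Pproj M (wS s) ?d i (\<lambda>_. 0)" using proj_0 by simp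
      next
        fix u assume "u \<in> Pproj M (wS s) ?d i (\<lambda>_. 0)"
        then have "u \<in> Pproj M (wS s) ?d i xi" by (simp only: cl(2))
        then obtain y where y: "feasible E N ?g ?d y" "\<And>e. e \<in> Ebuy E i \<Longrightarrow> y e = xi e" "u = proj y"
          unfolding Pproj by blast
        obtain z where z: "feasible E N c.g' c.D' z"
            "\<And>e'. e' \<in> Ebuy E i \<Longrightarrow> z e' = (if e' = e then \<delta> else 0)"
            "\<And>k. k \<in> N - {i} \<Longrightarrow> sum z (Ebuy E k) = sum (\<lambda>e. y e - xi e) (Ebuy E k)"
          using all[OF c.feasible_subtract_xi[OF y(1,2)]] by blast
        have "proj y = proj (\<lambda>e. z e + xi e)"
        proof
          fix k
          show "proj y k = proj (\<lambda>e. z e + xi e) k"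
          proof (cases "k \<in> N - {i}")
            case True
            then show ?thesis using z(3)[OF True] by (simp add: proj_def sum.distrib sum_subtractf)
          qed (auto simp: proj_def)
        qed
        moreover have "\<forall>e'\<in>Ebuy E i. z e' + xi e' = xi2 e'"
          using z(2) by (simp add: xi2_def)
        ultimately show "u \<in> Pproj M (wS s) ?d i xi2"
          unfolding Pproj using c.feasible_add_xi[OF z(1)] y(3) by blast
      qed
      moreover have "nonneg_on (Ebuy E i) xi2"
        using cl(1) e \<delta> by (auto simp: nonneg_on_def xi2_def)
      ultimately have "clinchable M (wS s) ?d i xi2" by (simp add: clinchable_def)
      moreover have "\<forall>e'. xi e' \<le> xi2 e'" using \<delta> by (simp add: xi2_def)
      moreover have "xi2 e \<noteq> xi e" using \<delta> by (simp add: xi2_def)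
      ultimately show False using max by (auto simp: max_clinchable_def)
    qed
  qed
  moreover have "cS s' = cS s" "lS s' = lS s" by (simp_all add: s')
  moreover have "srank s S - (if i \<in> S then a else 0) \<le> srank s' S" if "S \<subseteq> N" for S
    using c.rk_post_ge[OF that] unfolding srank_def res' dS' a_def .
  moreover have "srank s' N \<le> srank s N - a"
    using c.rk_post_all by (simp add: srank_def res' dS' a_def)
  ultimately show thesis using that a0 aD alloc' by blast
qed

definition potential :: "pca_state \<Rightarrow> nat set \<Rightarrow> real" where
  "potential s S = sum (alloc s) S + srank s S"

text \<open>By monotonicity of the rank this means equality: the other buyers can absorb all goods
  that are still sellable, so nothing is lost when the price of \<open>k\<close> rises.\<close>

definition slack :: "pca_state \<Rightarrow> nat \<Rightarrow> bool" where
  "slack s k \<longleftrightarrow> srank s N \<le> srank s (N - {k})"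

text \<open>Slackness of \<open>k\<close> arises when \<open>k\<close> clinches and survives later
  clinching by \<open>i\<close>: the rank of \<open>N\<close> falls by at least the clinched amount,
  that of \<open>N - {k}\<close> by at most this amount. Buyers who have dropped out have demand 0
  and receive nothing.\<close>

lemma clinch_list_effect:
  assumes "clinch_list M v is s s'" "set is \<subseteq> N" "good s"
  shows "good s' \<and> cS s' = cS s \<and> lS s' = lS s \<and>
    (\<forall>S. S \<subseteq> N \<longrightarrow> potential s S \<le> potential s' S) \<and>
    (\<forall>k\<in>N. v k \<le> cS s k \<longrightarrow> alloc s' k = alloc s k) \<and>
    (\<forall>k\<in>N. k \<in> set is \<or> slack s k \<longrightarrow> slack s' k)"
  using assms
proof (induction rule: clinch_list.induct)
  case (Nil s)
  then show ?case by simp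
next
  case (Cons i s s1 "is" s2)
  have iN: "i \<in> N" using Cons.prems by simp
  obtain a where a: "good s1" "cS s1 = cS s" "lS s1 = lS s" "0 \<le> a" "ereal a \<le> dS s i"
    "\<And>k. alloc s1 k = alloc s k + (if k = i then a else 0)"
    "\<And>S. S \<subseteq> N \<Longrightarrow> srank s S - (if i \<in> S then a else 0) \<le> srank s1 S"
    "srank s1 N \<le> srank s N - a" "srank s1 N \<le> srank s1 (N - {i})"
    using clinch_one_effect[OF Cons.prems(2) iN Cons.hyps(1)] by metis
  have IH: "good s2" "cS s2 = cS s1" "lS s2 = lS s1"
    "\<And>S. S \<subseteq> N \<Longrightarrow> potential s1 S \<le> potential s2 S"
    "\<And>k. k \<in> N \<Longrightarrow> v k \<le> cS s1 k \<Longrightarrow> alloc s2 k = alloc s1 k"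
    "\<And>k. k \<in> N \<Longrightarrow> k \<in> set is \<or> slack s1 k \<Longrightarrow> slack s2 k"
    using Cons.IH[OF _ a(1)] Cons.prems by auto
  have pot: "potential s S \<le> potential s1 S" if S: "S \<subseteq> N" for S
  proof -
    have "finite S" using S finite_N finite_subset by blast
    then have "sum (alloc s1) S = sum (alloc s) S + (if i \<in> S then a else 0)"
      by (simp add: a(6) sum.distrib)
    then show ?thesis using a(7)[OF S] by (simp add: potential_def)
  qed
  have "alloc s1 k = alloc s k" if "k \<in> N" "v k \<le> cS s k" for k
    using good_dropped[OF Cons.prems(2) that] a(4,5,6) by (auto simp: zero_ereal_def)
  moreover have "slack s1 k" if k: "k \<in> N" "k = i \<or> slack s k" for k
  proof (cases "k = i")
    case True
    then show ?thesis using a(9) by (simp add: slack_def)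
  next
    case False
    then have "srank s (N - {k}) - a \<le> srank s1 (N - {k})"
      using a(7)[of "N - {k}"] iN by auto
    then show ?thesis using a(8) k False by (simp add: slack_def)
  qed
  moreover have "potential s S \<le> potential s2 S" if "S \<subseteq> N" for S
    using pot[OF that] IH(4)[OF that] by (rule order_trans)
  ultimately show ?case
    using IH(1-3,5,6) a(2,3) by simp
qed

end

section \<open>Invariants of a run and the final allocation\<close>

locale auction_model = market_model +
  fixes eps :: real
  assumes eps_pos: "0 < eps"
    and bids_grid: "\<forall>i\<in>allN M. \<exists>k::nat. 0 < k \<and> vm M i = real k * eps"
begin

definition clock :: "pca_state \<Rightarrow> bool" where
  "clock s \<longleftrightarrow> (N \<noteq> {} \<longrightarrow> lS s \<in> N) \<and>
     (\<exists>A::nat. \<forall>k\<in>N. cS s k = real (if k < lS s then Suc A else A) * eps)"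

definition inv_active :: "pca_state \<Rightarrow> bool" where
  "inv_active s \<longleftrightarrow> (\<forall>T. T \<subseteq> {k \<in> N. cS s k < v k} \<longrightarrow> sum (xstar M) T \<le> potential s T)"

definition level :: "real \<Rightarrow> nat set" where
  "level \<theta> = {k \<in> N. \<theta> \<le> v k}"

text \<open>The rank of all of \<open>N\<close> appears, rather than that of the level set, because
  slackness protects precisely this rank against a price increase. Buyers below the level have
  dropped out and can no longer take a share of it.\<close>

definition inv_level :: "pca_state \<Rightarrow> bool" where
  "inv_level s \<longleftrightarrow> (\<forall>\<theta>. (\<forall>k\<in>N. v k < \<theta> \<longrightarrow> v k \<le> cS s k) \<longrightarrow>
     sum (xstar M) (level \<theta>) \<le> sum (alloc s) (level \<theta>) + srank s N)"

text \<open>Clocks and valuations are multiples of \<open>eps\<close>, so a clock below a valuation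
  is at least one full step below it.\<close>

lemma grid_step:
  assumes "clock s" "l \<in> N" "cS s l < v l"
  shows "cS s l + eps \<le> v l"
proof -
  obtain A :: nat where A: "cS s l = real A * eps"
    using assms(1,2) unfolding clock_def by blast
  obtain K :: nat where K: "v l = real K * eps" using bids_grid assms(2) by blast
  have "A < K" using assms(3) eps_pos by (simp add: A K)
  then have "real (Suc A) * eps \<le> real K * eps" using eps_pos by (intro mult_right_mono) auto
  then show ?thesis by (simp add: A K algebra_simps)
qed

lemma clock_spread:
  assumes "clock s" "k \<in> N" "l \<in> N"
  shows "cS s k \<le> cS s l + eps"
proof -
  obtain A :: nat where "\<forall>k\<in>N. cS s k = real (if k < lS s then Suc A else A) * eps"
    using assms(1) unfolding clock_def by blast
  then show ?thesis
    using assms(2,3) eps_pos by (auto simp: algebra_simps)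
qed

text \<open>What \<open>l\<close> holds has cost at most \<open>c'\<close> per unit, and the rest of
  her budget is converted at price \<open>c'\<close>. In total this is at least
  \<open>B / c'\<close>, hence at least \<open>B / v l\<close>, which bounds
  \<open>xstar M l\<close>.\<close>

lemma price_step_gain:
  assumes good: "good s" and l: "l \<in> N" and c': "cS s l \<le> c'" "0 < c'" "c' < v l"
    and fin: "(Bm M l - ereal (pS s l)) / ereal c' \<noteq> \<infinity>"
  shows "xstar M l \<le> alloc s l + real_of_ereal ((Bm M l - ereal (pS s l)) / ereal c')"
proof (cases "Bm M l")
  case (real r)
  have r0: "0 \<le> r" using Bm_nonneg[OF l] real by simp
  have "v l * xstar M l \<le> r" using xstar_budget[OF l] real by simp
  then have "xstar M l \<le> r / v l" using vm_pos[OF l] by (simp add: field_simps)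
  also have "\<dots> \<le> r / c'" using r0 c' by (intro divide_left_mono) auto
  also have "\<dots> \<le> alloc s l + (r - pS s l) / c'"
  proof -
    have "pS s l \<le> cS s l * alloc s l" using good l by (simp add: good_def)
    also have "\<dots> \<le> c' * alloc s l" using c' alloc_nonneg[OF good] by (intro mult_right_mono)
    finally show ?thesis using c' by (simp add: field_simps)
  qed
  also have "(r - pS s l) / c' = real_of_ereal ((Bm M l - ereal (pS s l)) / ereal c')"
    using c' real by simp
  finally show ?thesis .
next
  case PInf
  then show ?thesis using fin c' by simp
next
  case MInf
  then show ?thesis using Bm_nonneg[OF l] by simp
qed

lemma inv_step:
  assumes good: "good s" and clock: "clock s" and ia: "inv_active s" and il: "inv_level s"
    and iter: "pca_iter M eps v s s'"
  shows "good s' \<and> clock s' \<and> inv_active s' \<and> inv_level s'"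
proof -
  obtain s1 where cl: "clinch_list M v [1..<nb M + ms M + 1] s s1"
    and s'_raw: "s' = s1\<lparr> cS := (cS s1)(lS s1 := cS s1 (lS s1) + eps),
        dS := (dS s1)(lS s1 := dem M v ((cS s1)(lS s1 := cS s1 (lS s1) + eps)) (pS s1) (lS s1)),
        lS := lS s1 mod (nb M + ms M) + 1 \<rparr>"
    and ne: "N \<noteq> {}"
    using iter unfolding pca_iter_def Let_def by blast
  have list: "set [1..<nb M + ms M + 1] = N" by (auto simp: allN_def)
  have s1: "good s1" "cS s1 = cS s" "lS s1 = lS s"
    "\<And>S. S \<subseteq> N \<Longrightarrow> potential s S \<le> potential s1 S"
    "\<And>k. k \<in> N \<Longrightarrow> v k \<le> cS s k \<Longrightarrow> alloc s1 k = alloc s k"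
    "\<And>k. k \<in> N \<Longrightarrow> slack s1 k"
    using clinch_list_effect[OF cl _ good] list by auto
  define l where "l = lS s"
  define c' where "c' = cS s l + eps"
  define d' where "d' = dem M v ((cS s)(l := c')) (pS s1) l"
  have s': "s' = s1\<lparr> cS := (cS s)(l := c'), dS := (dS s1)(l := d'), lS := l mod (nb M + ms M) + 1 \<rparr>"
    by (simp add: s'_raw s1(2,3) l_def c'_def d'_def)
  have lN: "l \<in> N" using clock ne by (simp add: clock_def l_def)
  have goodk: "\<And>k. k \<in> N \<Longrightarrow> 0 \<le> cS s k \<and> ereal (pS s1 k) \<le> Bm M k \<and> pS s1 k \<le> cS s k * alloc s1 k"
    and dS1: "dS s1 = dem M v (cS s) (pS s1)" and inP1: "inP M (wS s1)"
    using s1(1) unfolding good_def s1(2) by auto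
  have c'_pos: "0 < c'" using goodk[OF lN] eps_pos by (simp add: c'_def)
  have c_le: "cS s k \<le> cS s' k" for k using eps_pos by (simp add: s' c'_def)
  have alloc': "alloc s' = alloc s1" by (simp add: s' alloc_def fun_eq_iff)
  have good': "good s'"
    unfolding good_def
  proof (intro conjI ballI)
    show "inP M (wS s')" using inP1 by (simp add: s')
    show "dS s' = dem M v (cS s') (pS s')"
      by (auto simp: s' dS1 d'_def dem_def fun_eq_iff)
    fix k assume k: "k \<in> N"
    show "0 \<le> cS s' k" using goodk[OF k] c_le[of k] by linarith
    show "ereal (pS s' k) \<le> Bm M k" using goodk[OF k] by (simp add: s')
    have "pS s' k \<le> cS s k * alloc s1 k" using goodk[OF k] by (simp add: s')
    also have "\<dots> \<le> cS s' k * alloc s1 k"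
      using c_le alloc_nonneg[OF s1(1)] by (rule mult_right_mono)
    finally show "pS s' k \<le> cS s' k * alloc s' k" by (simp add: alloc')
  qed
  interpret r: residual E N "res (wS s1)" "dS s1" by (rule good_residual[OF s1(1)])
  interpret r': residual E N "res (wS s')" "dS s'" by (rule good_residual[OF good'])
  have srank': "srank s' = rank_fn E (res (wS s1)) ((dS s1)(l := d'))"
    by (simp add: srank_def s')
  have srank1: "srank s1 = rank_fn E (res (wS s1)) (dS s1)"
    by (simp add: srank_def)
  have d'0: "0 \<le> d'"
    using r'.D_nonneg[OF lN] by (simp add: s')
  have srank_out: "srank s' S = srank s1 S" if "l \<notin> S" for S
    unfolding srank' srank1 by (rule r.rk_price_step_outside[OF that])

  have clock': "clock s'"
  proof -
    obtain A :: nat where A: "\<forall>k\<in>N. cS s k = real (if k < l then Suc A else A) * eps"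
      using clock unfolding clock_def l_def by blast
    have c'A: "c' = real (Suc A) * eps" using A lN by (simp add: c'_def algebra_simps)
    have lS': "lS s' = l mod (nb M + ms M) + 1" by (simp add: s')
    show ?thesis
    \<comment> \<open>On wrap-around all clocks have been raised once, so the base value becomes
      \<open>Suc A\<close> and no buyer lies before the pointer 1.\<close>
    proof (cases "l = nb M + ms M")
      case True
      then have l1: "lS s' = 1" by (simp add: lS')
      have "cS s' k = real (Suc A) * eps" if "k \<in> N" for k
        using A that True c'A by (cases "k = l") (auto simp: s' allN_def)
      then show ?thesis
        unfolding clock_def l1 using lN by (auto intro!: exI[of _ "Suc A"] simp: allN_def)
    next
      case False
      then have l1: "lS s' = Suc l" "Suc l \<in> N" using lN by (auto simp: lS' allN_def)
      have "cS s' k = real (if k < Suc l then Suc A else A) * eps" if "k \<in> N" for k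
        using A that c'A by (cases "k = l") (auto simp: s')
      then show ?thesis unfolding clock_def l1(1) using l1(2) by blast
    qed
  qed

  have ia': "inv_active s'"
    unfolding inv_active_def
  proof (intro allI impI)
    fix T assume T: "T \<subseteq> {k \<in> N. cS s' k < v k}"
    have TN: "T \<subseteq> N" using T by auto
    then have finT: "finite T" using finite_N finite_subset by blast
    have "{k \<in> N. cS s' k < v k} \<subseteq> {k \<in> N. cS s k < v k}"
      using c_le by (auto intro: le_less_trans)
    then have old: "sum (xstar M) U \<le> potential s1 U" if "U \<subseteq> T" for U
      using ia s1(4)[of U] that TN T unfolding inv_active_def by (meson order_trans)
    show "sum (xstar M) T \<le> potential s' T"
    proof (cases "l \<in> T")
      case False
      then show ?thesis using old[of T] srank_out by (simp add: potential_def alloc')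
    next
      case True
      then have c'v: "c' < v l" using T by (auto simp: s')
      have d': "d' = (Bm M l - ereal (pS s1 l)) / ereal c'"
        using c'v c'_pos by (simp add: d'_def dem_def)
      consider "srank s1 T \<le> srank s' T"
        | "d' \<noteq> \<infinity>" "srank s1 (T - {l}) + real_of_ereal d' \<le> srank s' T"
        using r.rk_price_step[OF TN True d'0] unfolding srank' srank1 by blast
      then show ?thesis
      proof cases
        case 1
        then show ?thesis using old[of T] by (simp add: potential_def alloc')
      next
        case 2
        \<comment> \<open>Here the new demand of \<open>l\<close> acts as a cap: \<open>l\<close>
          reaches \<open>xstar M l\<close> with her goods and \<open>d'\<close>, and
          \<open>T - {l}\<close> is covered by the invariant before the price step.\<close>
        have "xstar M l \<le> alloc s1 l + real_of_ereal d'"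
          unfolding d' using c'v c'_pos 2(1) s1(2) eps_pos
          by (intro price_step_gain[OF s1(1) lN]) (auto simp: c'_def d')
        moreover have "sum (xstar M) (T - {l}) \<le> potential s1 (T - {l})"
          by (rule old) auto
        moreover have "sum (xstar M) T = xstar M l + sum (xstar M) (T - {l})"
          "sum (alloc s1) T = alloc s1 l + sum (alloc s1) (T - {l})"
          using finT True by (simp_all add: sum.remove)
        ultimately show ?thesis using 2(2) by (simp add: potential_def alloc')
      qed
    qed
  qed

  have "inv_level s'"
    unfolding inv_level_def
  proof (intro allI impI)
    fix \<theta> assume drop: "\<forall>k\<in>N. v k < \<theta> \<longrightarrow> v k \<le> cS s' k"
    have lev: "level \<theta> \<subseteq> N" by (auto simp: level_def)
    show "sum (xstar M) (level \<theta>) \<le> sum (alloc s') (level \<theta>) + srank s' N"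
    proof (cases "\<forall>k\<in>N. v k < \<theta> \<longrightarrow> v k \<le> cS s k")
      case True
      \<comment> \<open>The buyers below \<theta> had dropped out before this round, so the
        allocation to the level plus the rank of \<open>N\<close> cannot fall during clinching.
        Slackness of \<open>l\<close> then carries the rank of \<open>N\<close> through the price
        step.\<close>
      have "sum (alloc s1) (N - level \<theta>) = sum (alloc s) (N - level \<theta>)"
        using True by (intro sum.cong refl s1(5)) (auto simp: level_def)
      moreover have "sum (alloc t) N = sum (alloc t) (N - level \<theta>) + sum (alloc t) (level \<theta>)" for t
        using sum.subset_diff[OF lev finite_N] .
      ultimately have "sum (alloc s) (level \<theta>) + srank s N \<le> sum (alloc s1) (level \<theta>) + srank s1 N"
        using s1(4)[of N] by (simp add: potential_def)
      moreover have "srank s1 N \<le> srank s' N"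
      proof -
        have "srank s1 N \<le> srank s1 (N - {l})" using s1(6)[OF lN] by (simp add: slack_def)
        also have "\<dots> = srank s' (N - {l})" using srank_out by simp
        also have "\<dots> \<le> srank s' N" unfolding srank_def by (rule r'.rk_mono) auto
        finally show ?thesis .
      qed
      moreover have "sum (xstar M) (level \<theta>) \<le> sum (alloc s) (level \<theta>) + srank s N"
        using il True unfolding inv_level_def by blast
      ultimately show ?thesis by (simp add: alloc')
    next
      case False
      \<comment> \<open>The price step has just made \<open>l\<close>, the last buyer below
        \<theta>, drop out. No clock exceeds \<open>c' \<le> v l < \<theta>\<close>, so the whole
        level is still active and \<open>inv_active\<close> hands its bound over to
        \<open>inv_level\<close>.\<close>
      then obtain k where k: "k \<in> N" "v k < \<theta>" "cS s k < v k" by force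
      then have "k = l" using drop by (cases "k = l") (auto simp: s')
      then have "c' \<le> v l" "v l < \<theta>" using k grid_step[OF clock] by (auto simp: c'_def)
      moreover have "cS s' j \<le> c'" if "j \<in> N" for j
        using clock_spread[OF clock that lN] by (simp add: s' c'_def)
      ultimately have "level \<theta> \<subseteq> {k \<in> N. cS s' k < v k}"
        by (force simp: level_def)
      then have "sum (xstar M) (level \<theta>) \<le> potential s' (level \<theta>)"
        using ia' unfolding inv_active_def by blast
      moreover have "srank s' (level \<theta>) \<le> srank s' N"
        unfolding srank_def using lev by (intro r'.rk_mono) auto
      ultimately show ?thesis by (simp add: potential_def)
    qed
  qed
  then show ?thesis using good' clock' ia' by blast
qed

text \<open>With all demands infinite nobody can be capped, so the rank of \<open>T\<close> is at
  least \<open>f (Ebuys E T)\<close>. At clock 0 nobody has dropped out, so the level condition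
  leaves only the set \<open>N\<close>.\<close>

lemma inv_init: "good pca_init \<and> clock pca_init \<and> inv_active pca_init \<and> inv_level pca_init"
proof -
  have alloc0: "alloc pca_init k = 0" for k
    by (simp add: alloc_def pca_init_def)
  have good: "good pca_init"
    unfolding good_def using f_nonneg_set Bm_nonneg alloc0
    by (auto simp: pca_init_def inP_iff nonneg_on_def dem_def fun_eq_iff zero_ereal_def[symmetric])
  have clock: "clock pca_init"
    by (auto simp: clock_def pca_init_def allN_def intro!: exI[of _ 0])
  interpret r: residual E N "res (wS pca_init)" "dS pca_init" by (rule good_residual[OF good])
  have pot: "sum (xstar M) T \<le> potential pca_init T" if T: "T \<subseteq> N" for T
  proof -
    obtain F H where FH: "F \<subseteq> E" "H \<subseteq> T" "Ebuys E H \<subseteq> F" "\<And>k. k \<in> T - H \<Longrightarrow> dS pca_init k \<noteq> \<infinity>"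
      "r.rk T = res (wS pca_init) F + r.cap (T - H)"
      using r.rk_attained[OF T] by blast
    have "T - H = {}" using FH(4) by (auto simp: pca_init_def)
    then have "T = H" using FH(2) by auto
    have "sum (xstar M) T \<le> f (Ebuys E T)" by (rule xstar_le[OF T])
    also have "\<dots> \<le> f F" using FH(3) \<open>T = H\<close> by (intro f_mono_set) simp
    also have "f F = srank pca_init T"
      unfolding srank_def FH(5) using \<open>T - H = {}\<close> by (simp add: res_def pca_init_def)
    finally show ?thesis by (simp add: potential_def alloc0)
  qed
  then have "inv_active pca_init" unfolding inv_active_def by auto
  moreover have "inv_level pca_init"
    unfolding inv_level_def
  proof (intro allI impI)
    fix \<theta> assume "\<forall>k\<in>N. v k < \<theta> \<longrightarrow> v k \<le> cS pca_init k"
    then have "level \<theta> = N" using vm_pos by (force simp: level_def pca_init_def)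
    then show "sum (xstar M) (level \<theta>) \<le> sum (alloc pca_init) (level \<theta>) + srank pca_init N"
      using pot[of N] by (simp add: potential_def)
  qed
  ultimately show ?thesis using good clock by blast
qed

lemma inv_run:
  assumes "(pca_iter M eps v)\<^sup>*\<^sup>* pca_init s"
  shows "good s \<and> clock s \<and> inv_active s \<and> inv_level s"
  using assms by (induction rule: rtranclp_induct) (use inv_init inv_step in blast)+

text \<open>At termination every rank is at most 0, by the pair \<open>({}, {})\<close>, so the
  invariants speak about the allocation alone. A demand may be 0 because the budget is spent while
  the clock is still below the valuation, so it is not certain that all buyers below \<theta> have
  reached their valuations, and both invariants are needed.\<close>

lemma final_level_dominates:
  assumes final: "pca_final M eps v s"
  shows "sum (xstar M) (level \<theta>) \<le> sum (alloc s) (level \<theta>)"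
proof -
  have inv: "good s" "clock s" "inv_active s" "inv_level s"
    using inv_run final unfolding pca_final_def by auto
  interpret r: residual E N "res (wS s)" "dS s" by (rule good_residual[OF inv(1)])
  have lev: "level \<theta> \<subseteq> N" by (auto simp: level_def)
  have srank0: "srank s S \<le> 0" if "S \<subseteq> N" for S
  proof -
    have d: "dS s k = 0" if "k \<in> S" for k
      using final \<open>S \<subseteq> N\<close> that by (auto simp: pca_final_def)
    have "srank s S \<le> res (wS s) {} + r.cap (S - {})"
      unfolding srank_def using that d by (intro r.rk_le) auto
    then show ?thesis using d r.g_empty by simp
  qed
  show ?thesis
  proof (cases "\<forall>k\<in>N. v k < \<theta> \<longrightarrow> v k \<le> cS s k")
    case True
    then have "sum (xstar M) (level \<theta>) \<le> sum (alloc s) (level \<theta>) + srank s N"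
      using inv(4) unfolding inv_level_def by blast
    then show ?thesis using srank0[of N] by simp
  next
    case False
    then obtain l where l: "l \<in> N" "v l < \<theta>" "cS s l < v l" by force
    \<comment> \<open>The clock of \<open>l\<close> is a full step below
      \<open>v l < \<theta>\<close> and clocks differ by at most one step, so every buyer of the
      level is below her valuation.\<close>
    have "cS s k < v k" if "k \<in> level \<theta>" for k
      using clock_spread[OF inv(2), of k l] grid_step[OF inv(2) l(1,3)] l that
      by (auto simp: level_def)
    then have "sum (xstar M) (level \<theta>) \<le> potential s (level \<theta>)"
      using inv(3) lev unfolding inv_active_def by blast
    then show ?thesis using srank0[OF lev] by (simp add: potential_def)
  qed
qed

lemma final_welfare:
  assumes "pca_final M eps v s"
  shows "(\<Sum>i\<in>N. v i * xstar M i) \<le> (\<Sum>i\<in>N. v i * sum (wS s) (Ebuy E i))"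
proof -
  have "0 \<le> (\<Sum>i\<in>N. v i * (alloc s i - xstar M i))"
    using final_level_dominates[OF assms]
    by (intro level_set_weighted_sum_nonneg[OF finite_N vm_pos]) (auto simp: sum_subtractf level_def)
  then show ?thesis
    by (simp add: right_diff_distrib sum_subtractf alloc_def)
qed

end

theorem theorem3p12:
  fixes M :: market and eps :: real and s :: pca_state
  assumes E0_sub: "E0 M \<subseteq> {1..nb M} \<times> {1..ms M}"
    and f_empty: "\<forall>j\<in>{1..ms M}. fs M j {} = 0"
    and f_nonneg: "\<forall>j\<in>{1..ms M}. \<forall>F. F \<subseteq> Esel (E0 M) j \<longrightarrow> 0 \<le> fs M j F"
    and f_mono: "\<forall>j\<in>{1..ms M}. \<forall>F G. F \<subseteq> G \<and> G \<subseteq> Esel (E0 M) j \<longrightarrow> fs M j F \<le> fs M j G"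
    and f_submod: "\<forall>j\<in>{1..ms M}. \<forall>F G. F \<subseteq> Esel (E0 M) j \<and> G \<subseteq> Esel (E0 M) j \<longrightarrow>
                     fs M j (F \<union> G) + fs M j (F \<inter> G) \<le> fs M j F + fs M j G"
    and v_pos: "\<forall>i\<in>{1..nb M}. 0 < val M i"
    and B_nonneg: "\<forall>i\<in>{1..nb M}. 0 \<le> bud M i"
    and rho_pos: "\<forall>j\<in>{1..ms M}. 0 < rho M j"
    and eps_pos: "0 < eps"
    and bids_grid: "\<forall>i\<in>allN M. \<exists>k::nat. 0 < k \<and> vm M i = real k * eps"
    and final: "pca_final M eps (vm M) s"
  shows "(\<Sum>i\<in>allN M. vm M i * sum (wS s) (Ebuy (Emod M) i)) \<ge> (\<Sum>i\<in>allN M. vm M i * xstar M i)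
         \<and> ereal (\<Sum>i\<in>allN M. vm M i * xstar M i) = LW_OPT M"
proof -
  interpret auction_model M eps
    by unfold_locales (fact assms)+
  show ?thesis
    using final_welfare[OF final] LW_OPT_xstar by blast
qed

end
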